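(* Let $\alpha\in(0,2)$, $\beta\in(0,1)$, $1\le q<\infty$, and let $\mu$ be a nonnegative Radon measure on $\mathbb{R}^{n+1}_+$. Then the embedding $$\|P_\alpha f\|_{L^q(\mathbb{R}^{n+1}_+,\mu)}\le C\,\|f\|_{\dot W^{\beta,1}(\mathbb{R}^n)}\quad\text{for all } f\in C_0^\infty(\mathbb{R}^n)$$ holds with some constant $C<\infty$ if and only if there is a constant $C'<\infty$ such that $$\mu(T(O))^{1/q}\le C'\,Per_\beta(O)\quad\text{for all bounded open sets } O\subseteq\mathbb{R}^n.$$
   Context: $\mathbb{R}^{n+1}_+:=\mathbb{R}^n\times(0,\infty)$, $n\ge1$. For $\alpha\in(0,2)$, $P_\alpha f(x,t)=\int_{\mathbb{R}^n}p^\alpha_t(x-y)f(y)\,dy$ with $p^\alpha_t(x)=c(n,\alpha)\,t^\alpha(|x|^2+t^2)^{-(n+\alpha)/2}$, $c(n,\alpha)=\frac{\Gamma((n+\alpha)/2)}{\pi^{n/2}\Gamma(\alpha/2)}$. For $\beta\in(0,1)$, $\|f\|_{\dot W^{\beta,1}(\mathbb{R}^n)}=\int_{\mathbb{R}^n}\frac{\|f(\cdot+h)-f(\cdot)\|_{L^1(\mathbb{R}^n)}}{|h|^{n+\beta}}\,dh$. Fractional perimeter of a measurable $E\subseteq\mathbb{R}^n$: $Per_\beta(E)=\int_E\int_{\mathbb{R}^n\setminus E}\frac{1}{|x-y|^{n+\beta}}\,dx\,dy$ (possibly $+\infty$). Tent: $T(O)=\{(x,r)\in\mathbb{R}^{n+1}_+:\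 B(x,r)\subseteq O\}$ for $O\subseteq\mathbb{R}^n$ open, with $B(x,r)$ the open ball in $\mathbb{R}^n$. *)

theory Defs
  imports "HOL-Analysis.Analysis"
begin

text \<open>
  \<open>\<real>\<^sup>n\<close> is \<^typ>\<open>real ^ 'n\<close>, so \<open>n = CARD('n) \<ge> 1\<close>. Quantities that may be infinite live in
  \<^typ>\<open>ennreal\<close>.
\<close>

definition half_space :: "((real ^ 'n) \<times> real) set" where
  "half_space = {(x, t). 0 < t}"

definition radon_measure_on :: "'a::topological_space set \<Rightarrow> 'a measure \<Rightarrow> bool" where
  "radon_measure_on U M \<longleftrightarrow>
     sets M = sets (restrict_space borel U) \<and>
     (\<forall>K. compact K \<and> K \<subseteq> U \<longrightarrow> emeasure M K < \<infinity>) \<and>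
     (\<forall>A\<in>sets M. emeasure M A =
        (INF V\<in>{V. openin (top_of_set U) V \<and> A \<subseteq> V}. emeasure M V)) \<and>
     (\<forall>V. openin (top_of_set U) V \<longrightarrow>
        emeasure M V = (SUP K\<in>{K. compact K \<and> K \<subseteq> V}. emeasure M K))"

text \<open>Powers with a positive exponent; the library has no \<open>powr\<close> on \<^typ>\<open>ennreal\<close>.\<close>

definition epowr :: "ennreal \<Rightarrow> real \<Rightarrow> ennreal" where
  "epowr x p = (if x = \<infinity> then \<infinity> else ennreal (enn2real x powr p))"

definition Lq_norm :: "'a measure \<Rightarrow> real \<Rightarrow> ('a \<Rightarrow> real) \<Rightarrow> ennreal" where
  "Lq_norm M q F = epowr (\<integral>\<^sup>+ z. ennreal (\<bar>F z\<bar> powr q) \<partial>M) (1 / q)"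

text \<open>
  \<open>Ck k f\<close>: \<open>f\<close> is of class \<open>C\<^sup>k\<close>, by recursion on the directional derivatives
  \<open>x \<mapsto> Df(x) v\<close>.
\<close>

fun Ck :: "nat \<Rightarrow> ('a::real_normed_vector \<Rightarrow> real) \<Rightarrow> bool" where
  "Ck 0 f \<longleftrightarrow> continuous_on UNIV f"
| "Ck (Suc k) f \<longleftrightarrow>
     (\<forall>x. f differentiable (at x)) \<and> (\<forall>v. Ck k (\<lambda>x. frechet_derivative f (at x) v))"

definition test_functions :: "('a::real_normed_vector \<Rightarrow> real) set" where
  "test_functions = {f. (\<forall>k. Ck k f) \<and> compact (closure {x. f x \<noteq> 0})}"

definition poisson_const :: "nat \<Rightarrow> real \<Rightarrow> real" where
  "poisson_const n \<alpha> =
     Gamma ((real n + \<alpha>) / 2) / (pi powr (real n / 2) * Gamma (\<alpha> / 2))"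

definition poisson_kernel :: "real \<Rightarrow> real \<Rightarrow> real ^ 'n \<Rightarrow> real" where
  "poisson_kernel \<alpha> t x =
     poisson_const CARD('n) \<alpha> * t powr \<alpha> *
       ((norm x)\<^sup>2 + t\<^sup>2) powr (- (real CARD('n) + \<alpha>) / 2)"

definition poisson_ext :: "real \<Rightarrow> (real ^ 'n \<Rightarrow> real) \<Rightarrow> (real ^ 'n) \<times> real \<Rightarrow> real" where
  "poisson_ext \<alpha> f = (\<lambda>(x, t). \<integral>y. poisson_kernel \<alpha> t (x - y) * f y \<partial>lborel)"

text \<open>The integrand vanishes at \<open>h = 0\<close>, as \<open>0 / 0 = 0\<close> in \<^typ>\<open>ennreal\<close>.\<close>

definition sobolev_seminorm :: "real \<Rightarrow> (real ^ 'n \<Rightarrow> real) \<Rightarrow> ennreal" where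
  "sobolev_seminorm \<beta> f =
     (\<integral>\<^sup>+ h. Lq_norm lborel 1 (\<lambda>x. f (x + h) - f x) /
        ennreal (norm h powr (real CARD('n) + \<beta>)) \<partial>lborel)"

text \<open>
  For Lebesgue measurable \<open>E\<close>; the integrals with respect to the completed measure and to
  \<^const>\<open>lborel\<close> agree.
\<close>

definition fractional_perimeter :: "real \<Rightarrow> (real ^ 'n) set \<Rightarrow> ennreal" where
  "fractional_perimeter \<beta> E =
     (\<integral>\<^sup>+ x\<in>E. (\<integral>\<^sup>+ y\<in>- E. ennreal (1 / norm (x - y) powr (real CARD('n) + \<beta>)) \<partial>lebesgue)
        \<partial>lebesgue)"

definition tent :: "(real ^ 'n) set \<Rightarrow> ((real ^ 'n) \<times> real) set" where
  "tent U = {(x, r). 0 < r \<and> ball x r \<subseteq> U}"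

end

theory Submission
  imports Defs
begin

text \<open>
  Tent inequality implies embedding: telescoping the averages of \<open>f\<close> over the balls
  \<open>B(x, 2\<^sup>k)\<close>, \<open>k \<in> \<int>\<close>, bounds \<open>\<bar>f\<bar>\<close> by a superposition of indicators of balls
  \<open>B(z, 2\<^sup>k)\<close>, weighted by the local oscillation of \<open>f\<close> near \<open>z\<close>. The sum of the weights times
  \<open>2\<^bsup>k(n-\<beta>)\<^esup>\<close> is at most a multiple of the seminorm of \<open>f\<close>, since \<open>\<bar>f(z) - f(w)\<bar>\<close> only occurs at
  the scales with \<open>\<bar>z - w\<bar> < 4 \<cdot> 2\<^sup>k\<close>. The Poisson extension of the indicator of a ball is at most
  \<open>C \<Sum>\<^sub>j 2\<^bsup>-jn\<^esup>\<close> times the indicator of the tent over the ball dilated by \<open>2\<^sup>j\<^sup>+\<^sup>1\<close>. Minkowski's integral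
  inequality (this is where \<open>q \<ge> 1\<close> enters) and \<open>Per(B(z, R)) \<le> C R\<^bsup>n-\<beta>\<^esup>\<close> conclude. Neither the coarea
  formula nor a capacitary estimate is needed.

  Embedding implies tent inequality: test with \<open>1\<^sub>U * \<phi>\<close> for a smooth bump \<open>\<phi>\<close> supported in the
  \<open>\<epsilon>\<close>-ball. Its seminorm is at most that of \<open>1\<^sub>U\<close>, which is \<open>2 Per(U)\<close>, and its extension is bounded
  below on the part \<open>t \<ge> 2\<epsilon>\<close> of the tent over \<open>U\<close>. Then let \<open>\<epsilon> \<rightarrow> 0\<close>.
\<close>

subsection \<open>Integrals of powers of the norm\<close>

text \<open>The exponents make so crude a decomposition affordable. Comparing the averages over
  radii \<open>2^k\<close> and \<open>2^(k+1)\<close> carries a factor \<open>2^(-2kn)\<close>, one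
  volume per ball. The kernel tail gives \<open>2^(-jn)\<close>, and the ball dilated by
  \<open>2^(j+1)\<close> has perimeter of order \<open>2^((k+j)(n-\<beta>))\<close>. The product is
  of order \<open>2^(-j\<beta>)\<close> times \<open>2^(-k(n+\<beta>))\<close>. The first factor is
  summable in j because \<beta> > 0. The second, summed over the scales with
  \<open>4 * 2^k > |z-w|\<close>, rebuilds the kernel \<open>|z-w|^(-n-\<beta>)\<close> of the
  seminorm. As the seminorm is linear in |f(z)-f(w)|, adding up loses only a constant. The condition
  \<beta> < 1 enters through the finite perimeter of balls. Only balls are tested, so the tent
  inequality for balls already implies it for all bounded open sets. In the converse, mollifying at
  scale eps can spoil the value 1 inside U only within distance eps of the complement. Hence the
  tent is cut off at height 2 eps, and all constants must be independent of eps.\<close>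

lemma nn_integral_lborel_shift:
  fixes f :: "'a::euclidean_space \<Rightarrow> ennreal"
  assumes [measurable]: "f \<in> borel_measurable borel"
  shows "(\<integral>\<^sup>+x. f (a + x) \<partial>lborel) = (\<integral>\<^sup>+x. f x \<partial>lborel)"
proof -
  have "(\<integral>\<^sup>+x. f x \<partial>lborel) = (\<integral>\<^sup>+x. f x \<partial>distr lborel borel ((+) a))"
    by (simp add: lborel_distr_plus)
  also have "\<dots> = (\<integral>\<^sup>+x. f (a + x) \<partial>lborel)"
    by (subst nn_integral_distr) auto
  finally show ?thesis by simp
qed

lemma nn_integral_lborel_reflect:
  fixes f :: "'a::euclidean_space \<Rightarrow> ennreal"
  assumes [measurable]: "f \<in> borel_measurable borel"
  shows "(\<integral>\<^sup>+x. f (a - x) \<partial>lborel) = (\<integral>\<^sup>+x. f x \<partial>lborel)"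
proof -
  have "lborel = density (distr lborel borel (\<lambda>x. a + (-1) *\<^sub>R x)) (\<lambda>_. ennreal (\<bar>-1\<bar>^DIM('a)))"
    by (rule lborel_affine) simp
  then have "(\<integral>\<^sup>+x. f x \<partial>lborel) = (\<integral>\<^sup>+x. f x \<partial>distr lborel borel (\<lambda>x. a + (-1) *\<^sub>R x))"
    by (simp add: density_1)
  also have "\<dots> = (\<integral>\<^sup>+x. f (a - x) \<partial>lborel)"
    by (subst nn_integral_distr) auto
  finally show ?thesis by simp
qed

lemma le_suminf_ennreal: "f j \<le> suminf (f :: nat \<Rightarrow> ennreal)"
  using sum_le_suminf[of f "{j}"] by simp

lemma dyadic_scale:
  fixes x :: real
  assumes "1 \<le> x"
  obtains j :: nat where "2 ^ j \<le> x" "x < 2 ^ Suc j"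
proof
  define j where "j = nat \<lfloor>log 2 x\<rfloor>"
  have 0: "0 \<le> log 2 x" using assms by simp
  have "real j \<le> log 2 x" "log 2 x < real (Suc j)" using 0 unfolding j_def by linarith+
  then have "2 powr real j \<le> x" "x < 2 powr real (Suc j)"
    using assms by (simp_all add: le_log_iff log_less_iff del: of_nat_Suc)
  then show "2 ^ j \<le> x" "x < 2 ^ Suc j" by (simp_all only: powr_realpow zero_less_numeral)
qed

text \<open>Common core of the next two lemmas. Each dyadic shell is enlarged to the full ball
  around 0, whose volume is explicit; this costs only a constant. The hypothesis on
  \<open>c j * r j ^ DIM('a)\<close> then turns the sum into a geometric series.\<close>

lemma nn_integral_shells:
  fixes F :: "'a::euclidean_space \<Rightarrow> ennreal"
  assumes F: "\<And>y. F y \<le> (\<Sum>j. ennreal (c j) * indicator (ball 0 (r j)) y)"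
    and c: "\<And>j. 0 \<le> c j" and r: "\<And>j. 0 < r j"
    and M: "\<And>j. c j * r j ^ DIM('a) \<le> M * s ^ j" and s: "0 \<le> s" "s < 1"
  shows "(\<integral>\<^sup>+y. F y \<partial>lborel) \<le> ennreal (unit_ball_vol DIM('a) * M / (1 - s))"
proof -
  have M0: "0 \<le> M"
    using order.trans[OF mult_nonneg_nonneg[OF c[of 0] zero_le_power[OF less_imp_le[OF r[of 0]]]] M[of 0]] by simp
  have "(\<integral>\<^sup>+y. F y \<partial>lborel) \<le> (\<integral>\<^sup>+y. (\<Sum>j. ennreal (c j) * indicator (ball (0::'a) (r j)) y) \<partial>lborel)"
    by (intro nn_integral_mono F)
  also have "\<dots> = (\<Sum>j. ennreal (c j) * emeasure lborel (ball (0::'a) (r j)))"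
  proof (subst nn_integral_suminf)
    have [measurable]: "ball (0::'a) (r i) \<in> sets borel" for i by simp
    show "(\<lambda>y. ennreal (c i) * indicator (ball (0::'a) (r i)) y) \<in> borel_measurable lborel" for i
      by measurable
    have "(\<integral>\<^sup>+y. ennreal (c i) * indicator (ball (0::'a) (r i)) y \<partial>lborel)
        = ennreal (c i) * emeasure lborel (ball (0::'a) (r i))" for i
      by (rule nn_integral_cmult_indicator) simp
    then show "(\<Sum>i. \<integral>\<^sup>+y. ennreal (c i) * indicator (ball (0::'a) (r i)) y \<partial>lborel)
        = (\<Sum>i. ennreal (c i) * emeasure lborel (ball (0::'a) (r i)))"
      by simp
  qed
  also have "\<dots> \<le> (\<Sum>j. ennreal (unit_ball_vol DIM('a) * M * s ^ j))"
  proof (intro suminf_le summableI)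
    fix j
    have "ennreal (c j) * emeasure lborel (ball (0::'a) (r j))
        = ennreal (unit_ball_vol DIM('a) * (c j * r j ^ DIM('a)))"
      using c r[of j] by (simp add: emeasure_ball ennreal_mult[symmetric] mult_ac)
    also have "\<dots> \<le> ennreal (unit_ball_vol DIM('a) * (M * s ^ j))"
      by (intro ennreal_leI mult_left_mono M) simp
    finally show "ennreal (c j) * emeasure lborel (ball (0::'a) (r j)) \<le> ennreal (unit_ball_vol DIM('a) * M * s ^ j)"
      by (simp add: mult_ac)
  qed
  also have "\<dots> = ennreal (unit_ball_vol DIM('a) * M / (1 - s))"
  proof (rule suminf_ennreal_eq)
    show "(\<lambda>j. unit_ball_vol DIM('a) * M * s ^ j) sums (unit_ball_vol DIM('a) * M / (1 - s))"
      using sums_mult[OF geometric_sums[of s], of "unit_ball_vol DIM('a) * M"] s by simp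
  qed (use s M0 in auto)
  finally show ?thesis .
qed

text \<open>On the shell between \<open>2^j R\<close> and \<open>2^(j+1) R\<close> the integrand is
  at most \<open>(2^j R)^(-n-\<gamma>)\<close>, so the shell contributes a constant times
  \<open>R^(-\<gamma>) 2^(-j\<gamma>)\<close>.\<close>

lemma nn_integral_norm_powr_outside:
  fixes \<gamma> :: real
  assumes \<gamma>: "0 < \<gamma>"
  shows "\<exists>C>0. \<forall>R>0. (\<integral>\<^sup>+y.
      ennreal (norm (y::'a::euclidean_space) powr - (DIM('a) + \<gamma>)) * indicator {y. R \<le> norm y} y \<partial>lborel)
    \<le> ennreal (C * R powr -\<gamma>)"
proof -
  let ?n = "DIM('a)" and ?s = "2 powr -\<gamma>"
  have s: "0 \<le> ?s" "?s < 1" using \<gamma> powr_less_mono[of "-\<gamma>" 0 2] by auto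
  let ?C = "unit_ball_vol ?n * 2 ^ ?n / (1 - ?s)"
  have "(\<integral>\<^sup>+y. ennreal (norm (y::'a) powr - (?n + \<gamma>)) * indicator {y. R \<le> norm y} y \<partial>lborel)
    \<le> ennreal (?C * R powr -\<gamma>)" if R: "0 < R" for R
  proof -
    define c where "c j = (2 ^ j * R) powr - (?n + \<gamma>)" for j :: nat
    define r where "r j = 2 ^ Suc j * R" for j :: nat
    have "(\<integral>\<^sup>+y. ennreal (norm (y::'a) powr - (?n + \<gamma>)) * indicator {y. R \<le> norm y} y \<partial>lborel)
      \<le> ennreal (unit_ball_vol ?n * (2 ^ ?n * R powr -\<gamma>) / (1 - ?s))"
    proof (rule nn_integral_shells[where c = c and r = r])
      fix y :: 'a
      show "ennreal (norm y powr - (?n + \<gamma>)) * indicator {y. R \<le> norm y} y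
        \<le> (\<Sum>j. ennreal (c j) * indicator (ball 0 (r j)) y)"
      proof (cases "R \<le> norm y")
        case True
        then have "1 \<le> norm y / R" using R by simp
        then obtain j :: nat where "2 ^ j \<le> norm y / R" "norm y / R < 2 ^ Suc j"
          by (rule dyadic_scale)
        then have j: "2 ^ j * R \<le> norm y" "norm y < r j"
          using R by (simp_all add: r_def pos_le_divide_eq pos_divide_less_eq)
        have "norm y powr - (?n + \<gamma>) \<le> c j"
          unfolding c_def using j R \<gamma> by (intro powr_mono2') auto
        then have "ennreal (norm y powr - (?n + \<gamma>)) * indicator {y. R \<le> norm y} y
          \<le> ennreal (c j) * indicator (ball 0 (r j)) y"
          using True j by (auto intro!: ennreal_leI)
        also have "\<dots> \<le> (\<Sum>j. ennreal (c j) * indicator (ball 0 (r j)) y)"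
          by (rule le_suminf_ennreal)
        finally show ?thesis .
      qed auto
    next
      fix j
      have "c j * r j ^ ?n = (2 ^ j * R) powr - (?n + \<gamma>) * ((2 ^ j * R) powr ?n * 2 ^ ?n)"
        using R by (simp add: c_def r_def powr_realpow power_mult_distrib)
      also have "\<dots> = 2 ^ ?n * ((2 ^ j * R) powr - (?n + \<gamma>) * (2 ^ j * R) powr ?n)"
        by simp
      also have "\<dots> = 2 ^ ?n * (2 ^ j * R) powr -\<gamma>"
        by (subst powr_add[symmetric]) simp
      also have "\<dots> = 2 ^ ?n * R powr -\<gamma> * ?s ^ j"
      proof -
        have "(2 ^ j * R) powr -\<gamma> = (2 powr real j) powr -\<gamma> * R powr -\<gamma>"
          using R by (simp add: powr_mult powr_realpow)
        also have "(2 powr real j) powr -\<gamma> = ?s powr real j"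
          by (simp add: powr_powr mult.commute)
        finally show ?thesis by (simp add: powr_realpow mult_ac)
      qed
      finally show "c j * r j ^ ?n \<le> 2 ^ ?n * R powr -\<gamma> * ?s ^ j" by simp
    qed (use s R in \<open>auto simp: c_def r_def\<close>)
    then show ?thesis by (simp add: mult_ac)
  qed
  moreover have "0 < ?C" using s by simp
  ultimately show ?thesis by blast
qed

text \<open>The same shells, now shrinking towards the origin. As \<gamma> \<le> n, the integrand
  does not increase with the norm, so its value at the inner radius \<open>r j / 2\<close> bounds it
  on a shell.\<close>

lemma nn_integral_norm_powr_inside:
  fixes \<gamma> :: real
  assumes \<gamma>: "0 < \<gamma>" "\<gamma> \<le> DIM('a::euclidean_space)"
  shows "\<exists>C>0. \<forall>R>0. (\<integral>\<^sup>+y.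
      ennreal (norm (y::'a) powr (\<gamma> - DIM('a))) * indicator {y. norm y < R} y \<partial>lborel)
    \<le> ennreal (C * R powr \<gamma>)"
proof -
  let ?n = "DIM('a)" and ?s = "2 powr -\<gamma>"
  have s: "0 \<le> ?s" "?s < 1" using \<gamma> powr_less_mono[of "-\<gamma>" 0 2] by auto
  let ?C = "unit_ball_vol ?n * 2 powr (?n - \<gamma>) / (1 - ?s)"
  have "(\<integral>\<^sup>+y. ennreal (norm (y::'a) powr (\<gamma> - ?n)) * indicator {y. norm y < R} y \<partial>lborel)
    \<le> ennreal (?C * R powr \<gamma>)" if R: "0 < R" for R
  proof -
    define r where "r j = R / 2 ^ j" for j :: nat
    define c where "c j = (r j / 2) powr (\<gamma> - ?n)" for j :: nat
    have r0: "0 < r j" for j using R by (simp add: r_def)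
    have "(\<integral>\<^sup>+y. ennreal (norm (y::'a) powr (\<gamma> - ?n)) * indicator {y. norm y < R} y \<partial>lborel)
      \<le> ennreal (unit_ball_vol ?n * (2 powr (?n - \<gamma>) * R powr \<gamma>) / (1 - ?s))"
    proof (rule nn_integral_shells[where c = c and r = r])
      fix y :: 'a
      show "ennreal (norm y powr (\<gamma> - ?n)) * indicator {y. norm y < R} y
        \<le> (\<Sum>j. ennreal (c j) * indicator (ball 0 (r j)) y)"
      \<comment> \<open>At \<open>y = 0\<close> the integrand is 0, since
        \<open>0 powr p = 0\<close>.\<close>
      proof (cases "norm y < R \<and> y \<noteq> 0")
        case True
        then have "1 \<le> R / norm y" by simp
        then obtain j :: nat where j0: "2 ^ j \<le> R / norm y" "R / norm y < 2 ^ Suc j"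
          by (rule dyadic_scale)
        have j: "r j / 2 \<le> norm y" "norm y \<le> r j"
          using True j0(1) order.strict_implies_order[OF j0(2)]
          by (simp_all add: r_def divide_simps mult_ac)
        show ?thesis
        proof (cases "norm y < r j")
          case less: True
          have "norm y powr (\<gamma> - ?n) \<le> c j"
            unfolding c_def using j r0[of j] \<gamma> by (intro powr_mono2') auto
          then have "ennreal (norm y powr (\<gamma> - ?n)) * indicator {y. norm y < R} y
            \<le> ennreal (c j) * indicator (ball 0 (r j)) y"
            using True less by (auto intro!: ennreal_leI)
          also have "\<dots> \<le> (\<Sum>j. ennreal (c j) * indicator (ball 0 (r j)) y)"
            by (rule le_suminf_ennreal)
          finally show ?thesis .
        next
          case False
          \<comment> \<open>\<open>dyadic_scale\<close> is half-open the wrong way round after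
            inversion: a point with norm exactly \<open>r j\<close> is outside the open ball of
            index j. The next larger shell covers it, and its coefficient is the exact value of the
            integrand there; it exists because \<open>norm y < R\<close>.\<close>
          with j have eq: "norm y = r j" by simp
          with True obtain i where i: "j = Suc i" by (cases j) (auto simp: r_def)
          have ri: "r i = 2 * r j" by (simp add: i r_def)
          have "norm y powr (\<gamma> - ?n) \<le> c i" "norm y < r i"
            using r0[of j] by (simp_all add: c_def eq ri)
          then have "ennreal (norm y powr (\<gamma> - ?n)) * indicator {y. norm y < R} y
            \<le> ennreal (c i) * indicator (ball 0 (r i)) y"
            using True by (auto intro!: ennreal_leI)
          also have "\<dots> \<le> (\<Sum>j. ennreal (c j) * indicator (ball 0 (r j)) y)"
            by (rule le_suminf_ennreal)
          finally show ?thesis .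
        qed
      qed auto
    next
      fix j
      have "c j * r j ^ ?n = (r j / 2) powr (\<gamma> - ?n) * ((r j / 2) powr ?n * 2 ^ ?n)"
        using r0[of j] by (simp add: c_def powr_realpow power_divide)
      also have "\<dots> = 2 ^ ?n * ((r j / 2) powr (\<gamma> - ?n) * (r j / 2) powr ?n)"
        by simp
      also have "\<dots> = 2 ^ ?n * (r j / 2) powr \<gamma>"
        by (subst powr_add[symmetric]) simp
      also have "\<dots> = 2 powr (?n - \<gamma>) * R powr \<gamma> * ?s ^ j"
      proof -
        have "(r j / 2) powr \<gamma> = R powr \<gamma> / (2 powr real j) powr \<gamma> / 2 powr \<gamma>"
          using R by (simp add: r_def powr_divide powr_mult powr_realpow)
        also have "(2 powr real j) powr \<gamma> = (2 powr \<gamma>) powr real j"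
          by (simp add: powr_powr mult.commute)
        also have "\<dots> = (2 powr \<gamma>) ^ j"
          by (simp add: powr_realpow)
        finally show ?thesis
          by (simp add: powr_diff powr_minus powr_realpow field_simps)
      qed
      finally show "c j * r j ^ ?n \<le> 2 powr (?n - \<gamma>) * R powr \<gamma> * ?s ^ j" by simp
    qed (use s R in \<open>auto simp: c_def r_def\<close>)
    then show ?thesis by (simp add: mult_ac)
  qed
  moreover have "0 < ?C" using s by simp
  ultimately show ?thesis by blast
qed

subsection \<open>Minkowski's integral inequality\<close>

lemma epowr_ennreal: "0 \<le> x \<Longrightarrow> epowr (ennreal x) p = ennreal (x powr p)"
  by (simp add: epowr_def)

lemma epowr_top [simp]: "epowr top p = top"
  by (simp add: epowr_def)

lemma epowr_mono:
  assumes "0 \<le> p" "x \<le> y"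
  shows "epowr x p \<le> epowr y p"
proof (cases y rule: ennreal_cases)
  case (real y')
  with assms obtain x' where "x = ennreal x'" "0 \<le> x'" "x' \<le> y'"
    by (cases x rule: ennreal_cases) (auto simp: top_unique)
  with real assms show ?thesis by (auto simp: epowr_ennreal intro!: ennreal_leI powr_mono2)
qed auto

lemma epowr_epowr_inverse:
  assumes "0 < p"
  shows "epowr (epowr x p) (1 / p) = x"
  using assms by (cases x rule: ennreal_cases) (auto simp: epowr_ennreal powr_powr)

text \<open>The convex function \<open>y powr q\<close> lies above its tangent at l. The inequality
  is arranged with nonnegative terms only, so that it can be integrated in \<open>ennreal\<close>
  without subtraction.\<close>

lemma Young_tangent:
  fixes q y l :: real
  assumes "1 \<le> q" "0 \<le> y" "0 \<le> l"
  shows "q * l powr (q - 1) * y \<le> y powr q + (q - 1) * l powr q"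
proof (cases "q = 1")
  case False
  with assms have q: "1 < q" by simp
  have "y * l powr (q - 1) \<le> y powr q / q + (l powr (q - 1)) powr (q / (q - 1)) / (q / (q - 1))"
    using q assms by (intro Youngs_inequality) (auto simp: field_simps)
  also have "(l powr (q - 1)) powr (q / (q - 1)) = l powr q"
    using q by (simp add: powr_powr)
  finally show ?thesis using q by (simp add: field_simps)
qed (use assms in auto)

text \<open>The function \<open>\<xi> \<mapsto> indicator S (\<xi>, i)\<close> has L^q norm at most
  \<open>a i\<close>, so this is Minkowski's inequality for a superposition of indicators with
  weights g. Writing A for the integral of \<open>g a\<close>, Jensen's inequality for the
  probability density \<open>g a / A\<close> bounds the q-th power of the superposition pointwise.
  Fubini and the bound \<open>a i powr q\<close> on the sections then give
  \<open>A powr q\<close>.\<close>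

lemma Minkowski_integral_indicator:
  fixes \<mu> :: "'b measure" and \<nu> :: "'i measure" and g :: "'i \<Rightarrow> ennreal" and a :: "'i \<Rightarrow> real"
  assumes "sigma_finite_measure \<mu>" "sigma_finite_measure \<nu>"
    and S [measurable]: "S \<in> sets (\<mu> \<Otimes>\<^sub>M \<nu>)"
    and g [measurable]: "g \<in> borel_measurable \<nu>"
    and a [measurable]: "a \<in> borel_measurable \<nu>" and a_pos: "\<And>i. 0 < a i"
    and q: "1 \<le> q"
    and le: "\<And>i. i \<in> space \<nu> \<Longrightarrow> emeasure \<mu> {\<xi>\<in>space \<mu>. (\<xi>, i) \<in> S} \<le> ennreal (a i powr q)"
  shows "(\<integral>\<^sup>+\<xi>. epowr (\<integral>\<^sup>+i. g i * indicator S (\<xi>, i) \<partial>\<nu>) q \<partial>\<mu>)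
    \<le> epowr (\<integral>\<^sup>+i. g i * ennreal (a i) \<partial>\<nu>) q"
proof -
  interpret pair_sigma_finite \<mu> \<nu>
    using assms by (simp add: pair_sigma_finite_def)
  let ?F = "\<lambda>\<xi>. \<integral>\<^sup>+i. g i * indicator S (\<xi>, i) \<partial>\<nu>"
  have sec [measurable]: "(\<lambda>i. indicator S (\<xi>, i) :: ennreal) \<in> borel_measurable \<nu>" if "\<xi> \<in> space \<mu>" for \<xi>
    using that by measurable
  consider (1) A where "0 \<le> A" "(\<integral>\<^sup>+i. g i * ennreal (a i) \<partial>\<nu>) = ennreal A"
    | (2) "(\<integral>\<^sup>+i. g i * ennreal (a i) \<partial>\<nu>) = top"
    by (cases "\<integral>\<^sup>+i. g i * ennreal (a i) \<partial>\<nu>" rule: ennreal_cases) auto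
  then show ?thesis
  proof cases
    case (1 A)
    show ?thesis
    proof (cases "A = 0")
      case True
      with 1 have "AE i in \<nu>. g i * ennreal (a i) = 0"
        using nn_integral_0_iff_AE[of "\<lambda>i. g i * ennreal (a i)" \<nu>] by simp
      then have ae: "AE i in \<nu>. g i = 0"
        using a_pos by (auto elim!: eventually_mono simp: ennreal_eq_0_iff not_le[symmetric])
      have "?F \<xi> = 0" for \<xi>
      proof -
        have "?F \<xi> = (\<integral>\<^sup>+i. 0 \<partial>\<nu>)"
          using ae by (intro nn_integral_cong_AE) (auto elim!: eventually_mono)
        then show ?thesis by simp
      qed
      then show ?thesis using q by (simp add: epowr_def)
    next
      case False
      with 1 have A0: "0 < A" by simp
      \<comment> \<open>The superposition is the mean of \<open>indicator S / a\<close>, scaled by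
        A, with respect to the density \<open>g a / A\<close>. Raising \<open>A / a i\<close> to the
        power q and multiplying by \<open>a i / A\<close> gives \<open>?c i\<close>.\<close>
      let ?c = "\<lambda>i. A powr (q - 1) * a i powr (1 - q)"
      let ?G = "\<lambda>\<xi>. \<integral>\<^sup>+i. g i * (ennreal (?c i) * indicator S (\<xi>, i)) \<partial>\<nu>"
      have point: "epowr (?F \<xi>) q \<le> ?G \<xi>" if \<xi>: "\<xi> \<in> space \<mu>" for \<xi>
      proof -
        note sec[OF \<xi>, measurable]
        \<comment> \<open>Jensen's inequality for the probability density \<open>g a / A\<close>: integrate the tangent line of
          \<open>y \<mapsto> y powr q\<close> at \<open>l\<close>, then take \<open>l\<close> to be the value of the integral.\<close>
        have tangent: "ennreal (q * l powr (q - 1)) * ?F \<xi> \<le> ?G \<xi> + ennreal ((q - 1) * l powr q)"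
          if l: "0 \<le> l" for l
        proof -
          have pt: "ennreal (q * l powr (q - 1)) * indicator S (\<xi>, i)
            \<le> ennreal (?c i) * indicator S (\<xi>, i) + ennreal ((q - 1) * l powr q / A) * ennreal (a i)" for i
          proof (cases "(\<xi>, i) \<in> S")
            case True
            have "q * l powr (q - 1) * (A / a i) \<le> (A / a i) powr q + (q - 1) * l powr q"
              using q l A0 a_pos[of i] by (intro Young_tangent) auto
            then have "q * l powr (q - 1) * (A / a i) * (a i / A)
              \<le> ((A / a i) powr q + (q - 1) * l powr q) * (a i / A)"
              using A0 a_pos[of i] by (intro mult_right_mono) auto
            moreover have "(A / a i) powr q * (a i / A) = ?c i"
              using A0 a_pos[of i] by (simp add: powr_divide powr_diff divide_simps)
            ultimately have "q * l powr (q - 1) \<le> ?c i + (q - 1) * l powr q / A * a i"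
              using A0 a_pos[of i] by (simp add: distrib_right add_divide_distrib)
            then show ?thesis
              using True A0 a_pos[of i] q
              by (simp add: ennreal_mult[symmetric] ennreal_plus[symmetric] ennreal_leI
                  del: ennreal_plus)
          qed auto
          have "ennreal (q * l powr (q - 1)) * ?F \<xi>
            = (\<integral>\<^sup>+i. g i * (ennreal (q * l powr (q - 1)) * indicator S (\<xi>, i)) \<partial>\<nu>)"
            by (subst nn_integral_cmult[symmetric]) (auto simp: mult_ac)
          also have "\<dots> \<le> (\<integral>\<^sup>+i. g i * (ennreal (?c i) * indicator S (\<xi>, i)) +
              ennreal ((q - 1) * l powr q / A) * (g i * ennreal (a i)) \<partial>\<nu>)"
          proof (rule nn_integral_mono)
            fix i
            show "g i * (ennreal (q * l powr (q - 1)) * indicator S (\<xi>, i))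
              \<le> g i * (ennreal (?c i) * indicator S (\<xi>, i)) +
                ennreal ((q - 1) * l powr q / A) * (g i * ennreal (a i))"
              using mult_left_mono[OF pt[of i], of "g i"] by (simp add: distrib_left mult_ac)
          qed
          also have "\<dots> = ?G \<xi> + ennreal ((q - 1) * l powr q / A) * (\<integral>\<^sup>+i. g i * ennreal (a i) \<partial>\<nu>)"
            by (subst nn_integral_add) (auto simp: nn_integral_cmult)
          also have "ennreal ((q - 1) * l powr q / A) * (\<integral>\<^sup>+i. g i * ennreal (a i) \<partial>\<nu>)
              = ennreal ((q - 1) * l powr q)"
            using 1 A0 q by (simp add: ennreal_mult[symmetric])
          finally show ?thesis .
        qed
        show ?thesis
        proof (cases "?F \<xi>" rule: ennreal_cases)
          case (real F)
          show ?thesis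
          proof (cases "?G \<xi>" rule: ennreal_cases)
            case G: (real G)
            have "ennreal (q * F powr (q - 1) * F) \<le> ennreal (G + (q - 1) * F powr q)"
              using tangent[OF real(1)] real G q by (simp add: ennreal_mult)
            then have "q * F powr (q - 1) * F \<le> G + (q - 1) * F powr q"
              using real G q by (subst (asm) ennreal_le_iff) auto
            moreover have "F powr (q - 1) * F = F powr q"
              using real(1) q by (cases "F = 0") (auto simp: powr_diff)
            ultimately have "F powr q \<le> G"
              by (simp add: mult.assoc) (simp add: algebra_simps)
            then show ?thesis using real G by (simp add: epowr_ennreal ennreal_leI)
          qed simp
        next
          case top
          \<comment> \<open>An infinite value of the integral cannot serve as the point of tangency;
            any fixed positive one, such as 1, already forces \<open>?G \<xi>\<close> to be
            infinite.\<close>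
          with tangent[of 1] q have "?G \<xi> + ennreal (q - 1) = top"
            by (simp add: ennreal_mult_top top_unique)
          then show ?thesis by simp
        qed
      qed
      have "(\<integral>\<^sup>+\<xi>. epowr (?F \<xi>) q \<partial>\<mu>) \<le> (\<integral>\<^sup>+\<xi>. ?G \<xi> \<partial>\<mu>)"
        by (intro nn_integral_mono point)
      also have "\<dots> = (\<integral>\<^sup>+i. (\<integral>\<^sup>+\<xi>. g i * (ennreal (?c i) * indicator S (\<xi>, i)) \<partial>\<mu>) \<partial>\<nu>)"
        by (rule Fubini'[symmetric]) measurable
      also have "\<dots> \<le> (\<integral>\<^sup>+i. ennreal (A powr (q - 1)) * (g i * ennreal (a i)) \<partial>\<nu>)"
      proof (rule nn_integral_mono)
        fix i assume i: "i \<in> space \<nu>"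
        have [measurable]: "(\<lambda>\<xi>. indicator S (\<xi>, i) :: ennreal) \<in> borel_measurable \<mu>"
          using i by measurable
        have "(\<integral>\<^sup>+\<xi>. g i * (ennreal (?c i) * indicator S (\<xi>, i)) \<partial>\<mu>)
          = g i * (ennreal (?c i) * (\<integral>\<^sup>+\<xi>. indicator S (\<xi>, i) \<partial>\<mu>))"
          by (simp add: nn_integral_cmult)
        also have "(\<integral>\<^sup>+\<xi>. indicator S (\<xi>, i) \<partial>\<mu>)
            = (\<integral>\<^sup>+\<xi>. indicator {\<xi>\<in>space \<mu>. (\<xi>, i) \<in> S} \<xi> \<partial>\<mu>)"
          by (intro nn_integral_cong) (auto simp: indicator_def)
        also have "\<dots> = emeasure \<mu> {\<xi>\<in>space \<mu>. (\<xi>, i) \<in> S}"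
          using i by (intro nn_integral_indicator) measurable
        also have "g i * (ennreal (?c i) * emeasure \<mu> {\<xi>\<in>space \<mu>. (\<xi>, i) \<in> S})
          \<le> g i * (ennreal (?c i) * ennreal (a i powr q))"
          by (intro mult_left_mono le i) auto
        also have "ennreal (?c i) * ennreal (a i powr q) = ennreal (A powr (q - 1)) * ennreal (a i)"
          using a_pos[of i] by (simp add: ennreal_mult[symmetric] powr_diff)
        finally show "(\<integral>\<^sup>+\<xi>. g i * (ennreal (?c i) * indicator S (\<xi>, i)) \<partial>\<mu>)
          \<le> ennreal (A powr (q - 1)) * (g i * ennreal (a i))"
          by (simp add: mult_ac)
      qed
      also have "\<dots> = ennreal (A powr (q - 1)) * ennreal A"
        by (subst nn_integral_cmult) (auto simp: 1)
      also have "\<dots> = epowr (ennreal A) q"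
        using A0 by (simp add: epowr_ennreal ennreal_mult[symmetric] powr_diff)
      finally show ?thesis by (simp add: 1)
    qed
  qed simp
qed

subsection \<open>Fractional perimeter and seminorm\<close>

lemma one_divide_powr: "1 / (x powr p) = x powr -p" for x :: real
  by (simp add: powr_minus_divide)

text \<open>The substitution y = x + h gives the perimeter the shape of the seminorm, an integral
  over shifts h. Both the bound for balls and the seminorm of an indicator are read off from this
  form.\<close>

lemma fractional_perimeter_eq_shift:
  fixes U :: "(real ^ 'n) set" and \<beta> :: real
  assumes [measurable]: "U \<in> sets borel"
  shows "fractional_perimeter \<beta> U =
    (\<integral>\<^sup>+h. (\<integral>\<^sup>+x. indicator U x * indicator (- U) (x + h) \<partial>lborel) *
      ennreal (norm h powr - (CARD('n) + \<beta>)) \<partial>lborel)"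
proof -
  let ?k = "\<lambda>h :: real ^ 'n. ennreal (norm h powr - (CARD('n) + \<beta>))"
  have "fractional_perimeter \<beta> U
    = (\<integral>\<^sup>+x. (\<integral>\<^sup>+y. ?k (x - y) * indicator (- U) y \<partial>lborel) * indicator U x \<partial>lborel)"
    by (simp add: fractional_perimeter_def nn_integral_completion one_divide_powr)
  also have "\<dots> = (\<integral>\<^sup>+x. (\<integral>\<^sup>+h. ?k h * indicator (- U) (x + h) \<partial>lborel) * indicator U x \<partial>lborel)"
  proof (intro nn_integral_cong)
    fix x :: "real ^ 'n"
    have "(\<integral>\<^sup>+y. ?k (x - y) * indicator (- U) y \<partial>lborel)
      = (\<integral>\<^sup>+h. ?k (x - (x + h)) * indicator (- U) (x + h) \<partial>lborel)"
      by (rule nn_integral_lborel_shift[symmetric]) measurable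
    then show "(\<integral>\<^sup>+y. ?k (x - y) * indicator (- U) y \<partial>lborel) * indicator U x
      = (\<integral>\<^sup>+h. ?k h * indicator (- U) (x + h) \<partial>lborel) * indicator U x"
      by simp
  qed
  also have "\<dots> = (\<integral>\<^sup>+x. (\<integral>\<^sup>+h. indicator U x * indicator (- U) (x + h) * ?k h \<partial>lborel) \<partial>lborel)"
    by (subst nn_integral_multc[symmetric]) (auto simp: mult_ac)
  also have "\<dots> = (\<integral>\<^sup>+h. (\<integral>\<^sup>+x. indicator U x * indicator (- U) (x + h) * ?k h \<partial>lborel) \<partial>lborel)"
    by (rule lborel_pair.Fubini') measurable
  also have "\<dots> = (\<integral>\<^sup>+h. (\<integral>\<^sup>+x. indicator U x * indicator (- U) (x + h) \<partial>lborel) * ?k h \<partial>lborel)"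
    by (subst nn_integral_multc) auto
  finally show ?thesis .
qed

lemma Lq_norm_1: "Lq_norm M 1 F = (\<integral>\<^sup>+x. ennreal \<bar>F x\<bar> \<partial>M)"
proof -
  have "epowr x 1 = x" for x by (cases x rule: ennreal_cases) (simp_all add: epowr_ennreal)
  then show ?thesis by (simp add: Lq_norm_def)
qed

lemma sobolev_seminorm_eq:
  fixes f :: "real ^ 'n \<Rightarrow> real" and \<beta> :: real
  shows "sobolev_seminorm \<beta> f =
    (\<integral>\<^sup>+h. (\<integral>\<^sup>+x. ennreal \<bar>f (x + h) - f x\<bar> \<partial>lborel) *
      ennreal (norm h powr - (CARD('n) + \<beta>)) \<partial>lborel)"
  unfolding sobolev_seminorm_def Lq_norm_1
proof (intro nn_integral_cong)
  fix h :: "real ^ 'n"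
  show "(\<integral>\<^sup>+x. ennreal \<bar>f (x + h) - f x\<bar> \<partial>lborel) / ennreal (norm h powr (CARD('n) + \<beta>))
    = (\<integral>\<^sup>+x. ennreal \<bar>f (x + h) - f x\<bar> \<partial>lborel) * ennreal (norm h powr - (CARD('n) + \<beta>))"
  proof (cases "h = 0")
    case False
    then show ?thesis
      by (simp add: divide_ennreal_def inverse_ennreal powr_minus del: minus_add_distrib)
  qed simp
qed

section \<open>Fractional perimeter of balls\<close>

lemma power_diff_le:
  fixes R d :: real
  assumes "0 < R" "0 \<le> d" "d \<le> R"
  shows "R ^ n - (R - d) ^ n \<le> n * R ^ n * (d / R)"
proof -
  have "1 + n * - (d / R) \<le> (1 + - (d / R)) ^ n"
    using assms by (intro Bernoulli_inequality) simp
  then have "R ^ n * (1 + n * - (d / R)) \<le> R ^ n * (1 + - (d / R)) ^ n"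
    using assms by (intro mult_left_mono) auto
  also have "\<dots> = (R - d) ^ n"
    using assms by (simp add: power_mult_distrib[symmetric] field_simps)
  finally show ?thesis by (simp add: algebra_simps)
qed

lemma emeasure_lborel_annulus_le:
  fixes a :: "'a::euclidean_space" and R d :: real
  assumes "0 < R" "0 \<le> d" "d \<le> R"
  shows "emeasure lborel (ball a R - ball a (R - d))
    \<le> ennreal (unit_ball_vol DIM('a) * (DIM('a) * R ^ DIM('a) * (d / R)))"
proof -
  have "emeasure lborel (ball a R - ball a (R - d))
    = emeasure lborel (ball a R) - emeasure lborel (ball a (R - d))"
    using assms by (intro emeasure_Diff) (auto simp: emeasure_ball)
  also have "\<dots> = ennreal (unit_ball_vol DIM('a) * (R ^ DIM('a) - (R - d) ^ DIM('a)))"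
    using assms by (simp add: emeasure_ball ennreal_minus right_diff_distrib)
  also have "\<dots> \<le> ennreal (unit_ball_vol DIM('a) * (DIM('a) * R ^ DIM('a) * (d / R)))"
    using assms by (intro ennreal_leI mult_left_mono power_diff_le) auto
  finally show ?thesis .
qed

text \<open>The points that the shift h moves out of the ball have measure at most the volume of the
  ball. For |h| < R they also lie in an annulus of width |h|, of measure at most a constant times
  \<open>R^(n-1) |h|\<close>. The first bound is used for |h| \<ge> R, where \<beta> > 0 gives
  convergence, the second for |h| < R, where \<beta> < 1 does; both parts are of order
  \<open>R^(n-\<beta>)\<close>.\<close>

lemma fractional_perimeter_ball_le:
  fixes \<beta> :: real
  assumes \<beta>: "0 < \<beta>" "\<beta> < 1"
  shows "\<exists>C>0. \<forall>R>0. \<forall>a :: real ^ 'n.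
    fractional_perimeter \<beta> (ball a R) \<le> ennreal (C * R powr (CARD('n) - \<beta>))"
proof -
  let ?n = "CARD('n)" and ?v = "unit_ball_vol CARD('n)"
  obtain C1 where C1: "0 < C1" "\<And>R. 0 < R \<Longrightarrow> (\<integral>\<^sup>+h.
      ennreal (norm (h :: real ^ 'n) powr - (?n + \<beta>)) * indicator {h. R \<le> norm h} h \<partial>lborel)
    \<le> ennreal (C1 * R powr -\<beta>)"
    using nn_integral_norm_powr_outside[where 'a = "real ^ 'n", OF \<beta>(1)] by auto
  have "1 \<le> ?n" by (simp add: Suc_le_eq)
  then have "1 - \<beta> \<le> ?n" using \<beta> by linarith
  then obtain C2 where C2: "0 < C2" "\<And>R. 0 < R \<Longrightarrow> (\<integral>\<^sup>+h.
      ennreal (norm (h :: real ^ 'n) powr (1 - \<beta> - ?n)) * indicator {h. norm h < R} h \<partial>lborel)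
    \<le> ennreal (C2 * R powr (1 - \<beta>))"
    using nn_integral_norm_powr_inside[where 'a = "real ^ 'n", of "1 - \<beta>"] \<beta> by auto
  let ?C = "?v * C1 + ?v * ?n * C2"
  have "fractional_perimeter \<beta> (ball a R) \<le> ennreal (?C * R powr (?n - \<beta>))"
    if R: "0 < R" for R and a :: "real ^ 'n"
  proof -
    let ?B = "ball a R" and ?k = "\<lambda>h :: real ^ 'n. norm h powr - (?n + \<beta>)"
      and ?k' = "\<lambda>h :: real ^ 'n. norm h powr (1 - \<beta> - ?n)"
    let ?m = "\<lambda>h. \<integral>\<^sup>+x. indicator ?B x * indicator (- ?B) (x + h) \<partial>lborel"
    have far: "?m h \<le> ennreal (?v * R ^ ?n)" for h
    proof -
      have "?m h \<le> (\<integral>\<^sup>+x. indicator ?B x \<partial>lborel)"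
        by (intro nn_integral_mono) (auto simp: indicator_def)
      then show ?thesis using R by (simp add: emeasure_ball)
    qed
    have near: "?m h \<le> ennreal (?v * (?n * R ^ ?n * (norm h / R)))" if h: "norm h < R" for h
    proof -
      have "?m h \<le> (\<integral>\<^sup>+x. indicator (?B - ball a (R - norm h)) x \<partial>lborel)"
      proof (intro nn_integral_mono)
        fix x
        have "dist a (x + h) \<le> dist a x + norm h"
          using dist_triangle[of a "x + h" x] by (simp add: dist_norm)
        then show "(indicator ?B x * indicator (- ?B) (x + h) :: ennreal)
          \<le> indicator (?B - ball a (R - norm h)) x"
          by (auto simp: indicator_def)
      qed
      also have "\<dots> \<le> ennreal (?v * (?n * R ^ ?n * (norm h / R)))"
        using emeasure_lborel_annulus_le[of R "norm h" a] h R by simp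
      finally show ?thesis .
    qed
    have "fractional_perimeter \<beta> ?B = (\<integral>\<^sup>+h. ?m h * ennreal (?k h) \<partial>lborel)"
      by (rule fractional_perimeter_eq_shift) simp
    also have "\<dots> \<le> (\<integral>\<^sup>+h. ennreal (?v * R ^ ?n) * (ennreal (?k h) * indicator {h. R \<le> norm h} h) +
      ennreal (?v * ?n * R ^ ?n / R) * (ennreal (?k' h) * indicator {h. norm h < R} h) \<partial>lborel)"
    proof (intro nn_integral_mono)
      fix h :: "real ^ 'n"
      show "?m h * ennreal (?k h) \<le> ennreal (?v * R ^ ?n) * (ennreal (?k h) * indicator {h. R \<le> norm h} h) +
        ennreal (?v * ?n * R ^ ?n / R) * (ennreal (?k' h) * indicator {h. norm h < R} h)"
      proof (cases "R \<le> norm h")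
        case True
        then show ?thesis using mult_right_mono[OF far[of h], of "ennreal (?k h)"] by simp
      next
        case False
        then have "?m h * ennreal (?k h) \<le> ennreal (?v * (?n * R ^ ?n * (norm h / R))) * ennreal (?k h)"
          by (intro mult_right_mono near) auto
        also have "\<dots> = ennreal (?v * ?n * R ^ ?n / R * (norm h * ?k h))"
          using R by (simp add: ennreal_mult[symmetric] mult_ac)
        also have "norm h * ?k h = ?k' h"
          by (cases "h = 0") (simp_all add: powr_mult_base algebra_simps)
        finally show ?thesis using False R by (simp add: ennreal_mult[symmetric])
      qed
    qed
    also have "\<dots> = ennreal (?v * R ^ ?n) *
        (\<integral>\<^sup>+h. ennreal (?k h) * indicator {h. R \<le> norm h} h \<partial>lborel) +
      ennreal (?v * ?n * R ^ ?n / R) *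
        (\<integral>\<^sup>+h. ennreal (?k' h) * indicator {h. norm h < R} h \<partial>lborel)"
      by (subst nn_integral_add, measurable, subst (1 2) nn_integral_cmult, measurable)
    also have "\<dots> \<le> ennreal (?v * R ^ ?n) * ennreal (C1 * R powr -\<beta>) +
      ennreal (?v * ?n * R ^ ?n / R) * ennreal (C2 * R powr (1 - \<beta>))"
      by (intro add_mono mult_left_mono C1 C2 R) auto
    also have "\<dots> = ennreal (?v * R ^ ?n * (C1 * R powr -\<beta>) + ?v * ?n * R ^ ?n / R * (C2 * R powr (1 - \<beta>)))"
      using R C1 C2 by (simp add: ennreal_mult[symmetric] ennreal_plus[symmetric] del: ennreal_plus)
    also have "?v * R ^ ?n * (C1 * R powr -\<beta>) + ?v * ?n * R ^ ?n / R * (C2 * R powr (1 - \<beta>))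
        = ?C * R powr (?n - \<beta>)"
      using R by (simp add: powr_realpow[symmetric] powr_diff powr_minus field_simps)
    finally show ?thesis .
  qed
  moreover have "0 < ?C" using C1 C2 by (auto intro!: add_pos_pos mult_pos_pos)
  ultimately show ?thesis by blast
qed

subsection \<open>Dyadic oscillations\<close>

lemma ball_borel_measurable [measurable]: "ball (x :: 'a::euclidean_space) r \<in> sets borel"
  by simp

text \<open>The distance from a constant to an average is at most the average distance to the
  constant. Multiplying through by the volume avoids division in \<open>ennreal\<close>. The
  constant c is free because it is later a value of f or the average over another ball.\<close>

lemma ball_average_diff_le:
  fixes f :: "'a::euclidean_space \<Rightarrow> real"
  assumes f: "integrable lborel f" and r: "0 < r"
  shows "ennreal (measure lborel (ball x r)) * ennreal \<bar>c - (LINT w:ball x r|lborel. f w) / measure lborel (ball x r)\<bar>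
    \<le> (\<integral>\<^sup>+w. indicator (ball x r) w * ennreal \<bar>c - f w\<bar> \<partial>lborel)"
proof -
  let ?V = "measure lborel (ball x r)"
  have V: "0 < ?V" using r by simp
  have fin: "emeasure lborel (ball x r) < top" using emeasure_lborel_ball_finite[of x r] by simp
  have int: "set_integrable lborel (ball x r) f"
    using integrable_mult_indicator[OF _ f, of "ball x r"] by (simp add: set_integrable_def)
  have intc: "set_integrable lborel (ball x r) (\<lambda>_. c)"
    unfolding set_integrable_def using fin by (intro integrable_scaleR_left integrable_real_indicator) auto
  have eq: "(LINT w:ball x r|lborel. c - f w) = ?V * (c - (LINT w:ball x r|lborel. f w) / ?V)"
  proof -
    have "(LINT w:ball x r|lborel. c) = c * ?V"
      using fin by (simp add: set_lebesgue_integral_def)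
    then show ?thesis
      using V by (subst set_integral_diff[OF intc int]) (simp add: field_simps)
  qed
  have "ennreal ?V * ennreal \<bar>c - (LINT w:ball x r|lborel. f w) / ?V\<bar>
    = ennreal (norm (LINT w:ball x r|lborel. c - f w))"
    unfolding eq using V by (simp add: ennreal_mult abs_mult)
  also have "\<dots> \<le> (\<integral>\<^sup>+w. ennreal (norm (indicator (ball x r) w *\<^sub>R (c - f w))) \<partial>lborel)"
    unfolding set_lebesgue_integral_def
    by (rule integral_norm_bound_ennreal) (use set_integral_diff(1)[OF intc int] in \<open>simp add: set_integrable_def\<close>)
  also have "\<dots> = (\<integral>\<^sup>+w. indicator (ball x r) w * ennreal \<bar>c - f w\<bar> \<partial>lborel)"
    by (intro nn_integral_cong) (auto simp: indicator_def)
  finally show ?thesis .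
qed

text \<open>\<open>ball_average_diff_le\<close> twice: first against the constant \<open>A R\<close>
  over the small ball, then against the constant \<open>f z\<close> over the large one.\<close>

lemma ball_averages_diff_le:
  fixes f :: "'a::euclidean_space \<Rightarrow> real" and x :: 'a
  defines "A r \<equiv> (LINT w:ball x r|lborel. f w) / measure lborel (ball x r)"
  assumes f: "integrable lborel f" and r: "0 < r" "0 < R"
  shows "ennreal (measure lborel (ball x r) * measure lborel (ball x R)) * ennreal \<bar>A R - A r\<bar>
    \<le> (\<integral>\<^sup>+z. indicator (ball x r) z * (\<integral>\<^sup>+w. indicator (ball x R) w * ennreal \<bar>f z - f w\<bar> \<partial>lborel) \<partial>lborel)"
proof -
  let ?V = "\<lambda>r. measure lborel (ball x r)"
  have [measurable]: "f \<in> borel_measurable borel" using f by auto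
  have "ennreal (?V r * ?V R) * ennreal \<bar>A R - A r\<bar> = ennreal (?V R) * (ennreal (?V r) * ennreal \<bar>A R - A r\<bar>)"
    by (simp add: ennreal_mult mult_ac)
  also have "\<dots> \<le> ennreal (?V R) * (\<integral>\<^sup>+z. indicator (ball x r) z * ennreal \<bar>A R - f z\<bar> \<partial>lborel)"
    unfolding A_def by (intro mult_left_mono ball_average_diff_le f r) auto
  also have "\<dots> = (\<integral>\<^sup>+z. ennreal (?V R) * (indicator (ball x r) z * ennreal \<bar>A R - f z\<bar>) \<partial>lborel)"
    by (rule nn_integral_cmult[symmetric]) measurable
  also have "\<dots> \<le> (\<integral>\<^sup>+z. indicator (ball x r) z * (\<integral>\<^sup>+w. indicator (ball x R) w * ennreal \<bar>f z - f w\<bar> \<partial>lborel) \<partial>lborel)"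
  proof (intro nn_integral_mono)
    fix z
    have "ennreal (?V R) * ennreal \<bar>f z - A R\<bar>
      \<le> (\<integral>\<^sup>+w. indicator (ball x R) w * ennreal \<bar>f z - f w\<bar> \<partial>lborel)"
      unfolding A_def by (intro ball_average_diff_le f r)
    then show "ennreal (?V R) * (indicator (ball x r) z * ennreal \<bar>A R - f z\<bar>)
      \<le> indicator (ball x r) z * (\<integral>\<^sup>+w. indicator (ball x R) w * ennreal \<bar>f z - f w\<bar> \<partial>lborel)"
      by (auto simp: indicator_def abs_minus_commute)
  qed
  finally show ?thesis .
qed

text \<open>The integral over a ball is bounded by the L^1 norm of f, while the volume grows at
  least like \<open>2 ^ m\<close>.\<close>

lemma ball_average_tendsto_0:
  fixes f :: "'a::euclidean_space \<Rightarrow> real" and x :: 'a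
  assumes f: "integrable lborel f"
  shows "(\<lambda>m. (LINT w:ball x (2 ^ m)|lborel. f w) / measure lborel (ball x (2 ^ m))) \<longlonglongrightarrow> 0"
proof -
  let ?I = "\<integral>w. \<bar>f w\<bar> \<partial>lborel"
  have bound: "norm ((LINT w:ball x (2 ^ m)|lborel. f w) / measure lborel (ball x (2 ^ m)))
    \<le> ?I / unit_ball_vol DIM('a) * (1 / 2) ^ m" for m
  proof -
    have I: "\<bar>LINT w:ball x (2 ^ m)|lborel. f w\<bar> \<le> ?I"
      unfolding set_lebesgue_integral_def
    proof (rule order.trans[OF integral_abs_bound integral_mono])
      show "integrable lborel (\<lambda>w. \<bar>indicator (ball x (2 ^ m)) w *\<^sub>R f w\<bar>)"
        using integrable_mult_indicator[OF _ f, of "ball x (2 ^ m)"] by auto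
    qed (use f in \<open>auto simp: indicator_def\<close>)
    have "(2::real) ^ m \<le> (2 ^ m) ^ DIM('a)"
      using DIM_positive[where 'a = 'a] by (intro self_le_power) auto
    then have "unit_ball_vol DIM('a) * 2 ^ m \<le> unit_ball_vol DIM('a) * (2 ^ m) ^ DIM('a)"
      by (intro mult_left_mono) auto
    then have V: "unit_ball_vol DIM('a) * 2 ^ m \<le> measure lborel (ball x (2 ^ m))"
      by (simp only: content_ball zero_le_power zero_le_numeral)
    have "\<bar>LINT w:ball x (2 ^ m)|lborel. f w\<bar> / measure lborel (ball x (2 ^ m))
      \<le> ?I / (unit_ball_vol DIM('a) * 2 ^ m)"
      by (intro frac_le I V) auto
    then show ?thesis by (simp add: power_divide)
  qed
  have "(\<lambda>m. ?I / unit_ball_vol DIM('a) * (1 / 2) ^ m) \<longlonglongrightarrow> ?I / unit_ball_vol DIM('a) * 0"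
    by (intro tendsto_mult tendsto_const LIMSEQ_realpow_zero) auto
  then show ?thesis
    unfolding mult_zero_right by (rule Lim_null_comparison[OF always_eventually[OF allI[OF bound]]])
qed

lemma ball_average_tendsto:
  fixes f :: "'a::euclidean_space \<Rightarrow> real" and x :: 'a
  assumes f: "integrable lborel f" and cont: "isCont f x"
  shows "(\<lambda>m. (LINT w:ball x (1 / 2 ^ m)|lborel. f w) / measure lborel (ball x (1 / 2 ^ m))) \<longlonglongrightarrow> f x"
proof (rule LIMSEQ_I)
  fix e :: real assume e: "0 < e"
  obtain d where d: "0 < d" "\<And>w. dist w x < d \<Longrightarrow> \<bar>f w - f x\<bar> < e / 2"
    using cont[unfolded continuous_at_eps_delta dist_real_def, rule_format, of "e / 2"] e by auto
  obtain M :: nat where M: "(1 / 2) ^ M < d"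
    using real_arch_pow_inv[OF d(1), of "1 / 2"] by auto
  have "norm ((LINT w:ball x (1 / 2 ^ m)|lborel. f w) / measure lborel (ball x (1 / 2 ^ m)) - f x) < e"
    if m: "M \<le> m" for m
  proof -
    let ?r = "1 / 2 ^ m :: real" and ?V = "measure lborel (ball x (1 / 2 ^ m))"
    define A where "A = (LINT w:ball x ?r|lborel. f w) / ?V"
    have "?r \<le> (1 / 2) ^ M"
      using power_decreasing[OF m, of "1 / 2 :: real"] by (simp add: power_divide)
    then have r: "?r < d" using M by simp
    have V: "0 < ?V" by simp
    have "ennreal ?V * ennreal \<bar>f x - (LINT w:ball x ?r|lborel. f w) / ?V\<bar>
      \<le> (\<integral>\<^sup>+w. indicator (ball x ?r) w * ennreal \<bar>f x - f w\<bar> \<partial>lborel)"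
      by (rule ball_average_diff_le[OF f]) simp
    also have "\<dots> \<le> (\<integral>\<^sup>+w. ennreal (e / 2) * indicator (ball x ?r) w \<partial>lborel)"
    proof (intro nn_integral_mono)
      fix w
      show "indicator (ball x ?r) w * ennreal \<bar>f x - f w\<bar> \<le> ennreal (e / 2) * indicator (ball x ?r) w"
        using d(2)[of w] r by (auto simp: indicator_def dist_commute abs_minus_commute intro!: ennreal_leI)
    qed
    also have "\<dots> = ennreal (e / 2) * emeasure lborel (ball x ?r)"
      by (rule nn_integral_cmult_indicator) simp
    also have "\<dots> = ennreal (e / 2 * ?V)"
    proof -
      have "emeasure lborel (ball x ?r) = ennreal ?V"
        using emeasure_lborel_ball_finite[of x ?r] by (intro emeasure_eq_ennreal_measure) auto
      then show ?thesis
        using e by (simp add: ennreal_mult[symmetric] del: content_ball_gt_0_iff)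
    qed
    finally have "ennreal (?V * \<bar>f x - A\<bar>) \<le> ennreal (e / 2 * ?V)"
      using V by (simp only: A_def[symmetric] ennreal_mult[symmetric] less_imp_le abs_ge_zero)
    then have "?V * \<bar>f x - A\<bar> \<le> ?V * (e / 2)"
      using V e by (subst (asm) ennreal_le_iff) (simp_all only: mult.commute zero_le_mult_iff, simp)
    then have "\<bar>f x - A\<bar> \<le> e / 2"
      using mult_le_cancel_left_pos[OF V] by blast
    then show ?thesis using e unfolding A_def[symmetric] real_norm_def by linarith
  qed
  then show "\<exists>M. \<forall>m\<ge>M. norm ((LINT w:ball x (1 / 2 ^ m)|lborel. f w) / measure lborel (ball x (1 / 2 ^ m)) - f x) < e"
    by blast
qed

text \<open>Deliberately not normalised by the volume of the ball: the normalisation sits in the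
  explicit power of the radius in \<open>ball_average_osc_le\<close>, where it can be combined with
  the perimeter of a ball.\<close>

definition local_osc :: "('a::euclidean_space \<Rightarrow> real) \<Rightarrow> real \<Rightarrow> 'a \<Rightarrow> ennreal" where
  "local_osc f r z = (\<integral>\<^sup>+w. indicator (ball z r) w * ennreal \<bar>f z - f w\<bar> \<partial>lborel)"

text \<open>Lets \<open>measurable\<close> handle indicators of balls whose centre is itself an
  integration variable.\<close>

lemma pred_mem_ball [measurable (raw)]:
  fixes f g :: "'b \<Rightarrow> 'a::euclidean_space"
  assumes [measurable]: "f \<in> borel_measurable M" "g \<in> borel_measurable M"
  shows "Measurable.pred M (\<lambda>x. f x \<in> ball (g x) r)"
  unfolding mem_ball by measurable

lemma local_osc_measurable [measurable]:
  assumes [measurable]: "f \<in> borel_measurable borel"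
  shows "local_osc f r \<in> borel_measurable borel"
  unfolding local_osc_def[abs_def] by measurable

text \<open>The aim is a right-hand side in which x occurs only in the indicator of a ball about z.
  If z is within r of x, then B(x, 2r) lies in B(z, 3r), hence in B(z, 4r), so the inner integral is
  absorbed into an oscillation around z. The prefactor is the reciprocal of the product of the
  volumes of B(x, r) and B(x, 2r).\<close>

lemma ball_average_osc_le:
  fixes f :: "'a::euclidean_space \<Rightarrow> real" and x :: 'a and k :: int
  defines "A r \<equiv> (LINT w:ball x r|lborel. f w) / measure lborel (ball x r)"
  assumes f: "integrable lborel f"
  shows "ennreal \<bar>A (2 powr (k + 1)) - A (2 powr k)\<bar>
    \<le> ennreal (1 / ((unit_ball_vol DIM('a))\<^sup>2 * 2 ^ DIM('a)) * (2 powr k) powr - (2 * DIM('a))) *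
      (\<integral>\<^sup>+z. indicator (ball z (2 powr k)) x * local_osc f (4 * 2 powr k) z \<partial>lborel)"
proof -
  define r :: real where "r = 2 powr k"
  have r: "0 < r" "2 powr (k + 1) = 2 * r" by (simp_all add: r_def powr_add)
  define c where "c = 1 / ((unit_ball_vol DIM('a))\<^sup>2 * 2 ^ DIM('a)) * r powr - (2 * DIM('a))"
  have V: "measure lborel (ball x r) * measure lborel (ball x (2 * r)) = 1 / c"
  proof -
    have "r powr - (2 * DIM('a)) = 1 / (r ^ DIM('a) * r ^ DIM('a))"
      using r(1) by (simp add: powr_minus_divide powr_realpow[symmetric] powr_add[symmetric])
    then show ?thesis
      using r(1) by (simp add: content_ball c_def less_imp_neq[OF unit_ball_vol_pos, symmetric] power2_eq_square power_mult_distrib)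
  qed
  have c: "0 < c" unfolding c_def using r(1) by (intro mult_pos_pos divide_pos_pos zero_less_power) auto
  have "ennreal \<bar>A (2 * r) - A r\<bar> = ennreal c * (ennreal (1 / c) * ennreal \<bar>A (2 * r) - A r\<bar>)"
    using c by (simp add: ennreal_mult[symmetric])
  also have "\<dots> \<le> ennreal c * (\<integral>\<^sup>+z. indicator (ball x r) z *
      (\<integral>\<^sup>+w. indicator (ball x (2 * r)) w * ennreal \<bar>f z - f w\<bar> \<partial>lborel) \<partial>lborel)"
    unfolding V[symmetric] A_def using r by (intro mult_left_mono ball_averages_diff_le f) auto
  also have "\<dots> \<le> ennreal c * (\<integral>\<^sup>+z. indicator (ball z r) x * local_osc f (4 * r) z \<partial>lborel)"
  proof (intro mult_left_mono nn_integral_mono)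
    fix z
    show "indicator (ball x r) z * (\<integral>\<^sup>+w. indicator (ball x (2 * r)) w * ennreal \<bar>f z - f w\<bar> \<partial>lborel)
      \<le> indicator (ball z r) x * local_osc f (4 * r) z"
    proof (cases "dist x z < r")
      case True
      have "(\<integral>\<^sup>+w. indicator (ball x (2 * r)) w * ennreal \<bar>f z - f w\<bar> \<partial>lborel) \<le> local_osc f (4 * r) z"
        unfolding local_osc_def
      proof (intro nn_integral_mono mult_right_mono)
        fix w
        have "dist z w \<le> dist x z + dist x w" by (rule dist_triangle3)
        then show "(indicator (ball x (2 * r)) w :: ennreal) \<le> indicator (ball z (4 * r)) w"
          using True r(1) by (auto simp: indicator_def)
      qed auto
      then show ?thesis using True by (simp add: dist_commute)
    qed simp
  qed auto
  finally show ?thesis by (simp only: r_def[symmetric] r(2) c_def)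
qed

text \<open>The averages tend to 0 at large scales because f is integrable, and to
  \<open>f x\<close> at small scales by continuity, so \<open>f x\<close> is the telescoping sum of
  the differences over all scales. Integrating against the counting measure on the integers makes
  every finite stretch of the sum bounded by the total.\<close>

lemma abs_le_dyadic_osc:
  fixes f :: "'a::euclidean_space \<Rightarrow> real"
  assumes f: "integrable lborel f" and cont: "isCont f x"
  shows "ennreal \<bar>f x\<bar> \<le> (\<integral>\<^sup>+k.
      ennreal (1 / ((unit_ball_vol DIM('a))\<^sup>2 * 2 ^ DIM('a)) * (2 powr real_of_int k) powr - (2 * DIM('a))) *
      (\<integral>\<^sup>+z. indicator (ball z (2 powr real_of_int k)) x * local_osc f (4 * 2 powr real_of_int k) z \<partial>lborel) \<partial>count_space UNIV)"
    (is "_ \<le> (\<integral>\<^sup>+k. ?D k \<partial>count_space UNIV)")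
proof -
  define A where "A r = (LINT w:ball x r|lborel. f w) / measure lborel (ball x r)" for r
  let ?T = "\<integral>\<^sup>+k. ?D k \<partial>count_space UNIV"
  have step: "ennreal \<bar>A (2 powr (real_of_int (k + 1))) - A (2 powr real_of_int k)\<bar> \<le> ?D k" for k
    using ball_average_osc_le[OF f, of x k] by (simp only: A_def of_int_add of_int_1)
  have tele: "ennreal \<bar>A (2 powr real_of_int (a + int j)) - A (2 powr a)\<bar> \<le> (\<Sum>i<j. ?D (a + int i))" for a j
  proof (induction j)
    case (Suc j)
    have "\<bar>A (2 powr real_of_int (a + int (Suc j))) - A (2 powr a)\<bar>
      \<le> \<bar>A (2 powr real_of_int (a + int j + 1)) - A (2 powr real_of_int (a + int j))\<bar>
        + \<bar>A (2 powr real_of_int (a + int j)) - A (2 powr a)\<bar>"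
      by (simp add: ac_simps)
    then have "ennreal \<bar>A (2 powr real_of_int (a + int (Suc j))) - A (2 powr a)\<bar>
      \<le> ennreal \<bar>A (2 powr real_of_int (a + int j + 1)) - A (2 powr real_of_int (a + int j))\<bar>
        + ennreal \<bar>A (2 powr real_of_int (a + int j)) - A (2 powr a)\<bar>"
      by (simp only: ennreal_plus[symmetric] abs_ge_zero ennreal_leI)
    also have "\<dots> \<le> ?D (a + int j) + (\<Sum>i<j. ?D (a + int i))"
      by (intro add_mono step Suc.IH)
    finally show ?case by (simp add: add.commute)
  qed simp
  have sum_le: "(\<Sum>i<j. ?D (a + int i)) \<le> ?T" for a j
  proof -
    have "(\<Sum>i<j. ?D (a + int i)) = (\<Sum>k\<in>(\<lambda>i. a + int i) ` {..<j}. ?D k)"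
      by (subst sum.reindex) (auto simp: inj_on_def)
    also have "\<dots> = (\<integral>\<^sup>+k. ?D k \<partial>count_space ((\<lambda>i. a + int i) ` {..<j}))"
      by (subst nn_integral_count_space_finite) auto
    also have "\<dots> = (\<integral>\<^sup>+k. ?D k * indicator ((\<lambda>i. a + int i) ` {..<j}) k \<partial>count_space UNIV)"
      by (subst nn_integral_count_space_indicator) auto
    also have "\<dots> \<le> ?T"
      by (intro nn_integral_mono) (auto simp: indicator_def)
    finally show ?thesis .
  qed
  \<comment> \<open>Starting at scale \<open>2^(-m)\<close>, \<open>2 * m\<close> doublings reach
    \<open>2^m\<close>, so one index drives both ends to their limits.\<close>
  have le: "ennreal \<bar>A (2 ^ m) - A (1 / 2 ^ m)\<bar> \<le> ?T" for m :: nat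
  proof -
    have "2 powr real_of_int (- int m + int (2 * m)) = 2 ^ m" "2 powr real_of_int (- int m) = 1 / 2 ^ m"
      by (simp_all add: powr_realpow powr_minus_divide)
    then show ?thesis using order.trans[OF tele[of "- int m" "2 * m"] sum_le] by metis
  qed
  have lim: "(\<lambda>m. ennreal \<bar>A (2 ^ m) - A (1 / 2 ^ m)\<bar>) \<longlonglongrightarrow> ennreal \<bar>0 - f x\<bar>"
    unfolding A_def
    by (intro tendsto_ennrealI tendsto_rabs tendsto_diff ball_average_tendsto_0 ball_average_tendsto f cont)
  show ?thesis
    using LIMSEQ_le_const2[OF lim] le by (simp only: abs_minus_cancel diff_0) blast
qed

text \<open>A geometric series starting at the first scale comparable with d. It recovers the
  singular kernel of the seminorm from the sum over scales.\<close>

lemma nn_integral_dyadic_tail: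
  fixes p :: real
  assumes p: "0 < p"
  shows "\<exists>C>0. \<forall>d>0. (\<integral>\<^sup>+k. ennreal ((2 powr real_of_int k) powr -p) * indicator {k. d < 4 * 2 powr real_of_int k} k \<partial>count_space UNIV)
    \<le> ennreal (C * d powr -p)"
proof -
  let ?s = "2 powr -p" and ?C = "8 powr p / (1 - 2 powr -p)"
  have s: "0 < ?s" "?s < 1" using p powr_less_mono[of "-p" 0 2] by auto
  have "(\<integral>\<^sup>+k. ennreal ((2 powr real_of_int k) powr -p) * indicator {k. d < 4 * 2 powr real_of_int k} k \<partial>count_space UNIV)
    \<le> ennreal (?C * d powr -p)" if d: "0 < d" for d
  proof -
    \<comment> \<open>A lower bound for the admissible scales, possibly not the sharpest. Rounding
      down loses at most one more factor 2, so \<open>2^K\<close> is still at least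
      \<open>d / 8\<close>; this is where \<open>8 powr p\<close> comes from.\<close>
    define K where "K = \<lfloor>log 2 d\<rfloor> - 2"
    have ge: "K \<le> k" if "d < 4 * 2 powr real_of_int k" for k :: int
    proof -
      have "4 * 2 powr real_of_int k = (2::real) powr (k + 2)" by (simp add: powr_add)
      with that d have "log 2 d < k + 2" by (simp add: log_less_iff)
      then show ?thesis unfolding K_def by linarith
    qed
    have K: "d / 8 \<le> 2 powr K"
    proof -
      have "log 2 d - 3 \<le> K" unfolding K_def by linarith
      then have "2 powr (log 2 d - 3) \<le> 2 powr K" by simp
      then show ?thesis using d by (simp add: powr_diff)
    qed
    have "(\<integral>\<^sup>+k. ennreal ((2 powr real_of_int k) powr -p) * indicator {k. d < 4 * 2 powr real_of_int k} k \<partial>count_space UNIV)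
      \<le> (\<integral>\<^sup>+k. ennreal ((2 powr real_of_int k) powr -p) * indicator {K..} k \<partial>count_space UNIV)"
      by (intro nn_integral_mono mult_left_mono) (auto simp: indicator_def ge)
    also have "\<dots> = (\<integral>\<^sup>+k. ennreal ((2 powr real_of_int k) powr -p) \<partial>count_space {K..})"
      by (subst nn_integral_count_space_indicator) auto
    also have "\<dots> = (\<integral>\<^sup>+j. ennreal ((2 powr real_of_int (K + int j)) powr -p) \<partial>count_space UNIV)"
    proof (rule nn_integral_bij_count_space[symmetric])
      show "bij_betw (\<lambda>j. K + int j) UNIV {K..}"
        by (rule bij_betwI[where g = "\<lambda>k. nat (k - K)"]) auto
    qed
    also have "\<dots> = (\<Sum>j. ennreal ((2 powr K) powr -p * ?s ^ j))"
      by (simp add: nn_integral_count_space_nat powr_add powr_mult powr_powr powr_realpow[symmetric] mult.commute)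
    also have "\<dots> = ennreal ((2 powr K) powr -p * (1 / (1 - ?s)))"
      using s by (intro suminf_ennreal_eq sums_mult geometric_sums) auto
    also have "\<dots> \<le> ennreal ((d / 8) powr -p * (1 / (1 - ?s)))"
      using s d K p by (intro ennreal_leI mult_right_mono powr_mono2') auto
    also have "(d / 8) powr -p * (1 / (1 - ?s)) = ?C * d powr -p"
      using d by (simp add: powr_divide powr_minus field_simps)
    finally show ?thesis .
  qed
  moreover have "0 < ?C" using s by simp
  ultimately show ?thesis by blast
qed

subsection \<open>The Poisson kernel\<close>

lemma poisson_const_pos: "0 < \<alpha> \<Longrightarrow> 0 < poisson_const n \<alpha>"
  unfolding poisson_const_def by (intro divide_pos_pos mult_pos_pos Gamma_real_pos) auto

lemma poisson_kernel_nonneg: "0 < \<alpha> \<Longrightarrow> 0 \<le> poisson_kernel \<alpha> t x"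
  unfolding poisson_kernel_def using poisson_const_pos[of \<alpha>] by (simp add: less_imp_le)

lemma poisson_kernel_measurable [measurable]: "poisson_kernel \<alpha> t \<in> borel_measurable borel"
  unfolding poisson_kernel_def[abs_def] by measurable

lemma powr_half_square: "0 \<le> x \<Longrightarrow> (x\<^sup>2) powr (p / 2) = x powr p" for x :: real
  by (cases "x = 0") (simp_all add: powr_powr powr_realpow[symmetric] powr_numeral[symmetric] del: powr_numeral)

lemma poisson_kernel_le_outside:
  fixes y :: "real ^ 'n" and \<alpha> :: real
  assumes "0 < \<alpha>" "0 < t" "y \<noteq> 0"
  shows "poisson_kernel \<alpha> t y \<le> poisson_const CARD('n) \<alpha> * t powr \<alpha> * norm y powr - (CARD('n) + \<alpha>)"
proof -
  have "((norm y)\<^sup>2 + t\<^sup>2) powr (- (CARD('n) + \<alpha>) / 2) \<le> ((norm y)\<^sup>2) powr (- (CARD('n) + \<alpha>) / 2)"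
    using assms by (intro powr_mono2') auto
  also have "\<dots> = norm y powr - (CARD('n) + \<alpha>)"
    by (rule powr_half_square) simp
  finally show ?thesis
    unfolding poisson_kernel_def using assms poisson_const_pos[of \<alpha> "CARD('n)"]
    by (intro mult_left_mono) auto
qed

lemma powr_half_square_div: "0 \<le> u \<Longrightarrow> (u\<^sup>2 / 2) powr (- p / 2) = 2 powr (p / 2) * u powr -p"
  for u p :: real
  by (subst powr_divide) (simp_all only: powr_half_square zero_le_power2 zero_le_numeral,
      simp add: powr_minus field_simps)

text \<open>Two crude bounds, \<open>(|y| + t)^2 \<le> 2 (|y|^2 + t^2)\<close> and
  \<open>t^\<alpha> \<le> (|y| + t)^\<alpha>\<close>. They give up the faster decay in y but leave
  an expression in |y| + t alone, the quantity that decides membership in the tent over a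
  ball.\<close>

lemma poisson_kernel_le_sum:
  fixes y :: "real ^ 'n" and \<alpha> t :: real
  assumes \<alpha>: "0 < \<alpha>" and t: "0 < t"
  shows "poisson_kernel \<alpha> t y \<le> poisson_const CARD('n) \<alpha> * 2 powr ((CARD('n) + \<alpha>) / 2) / (norm y + t) ^ CARD('n)"
proof -
  let ?p = "CARD('n) + \<alpha>"
  have "(norm y + t)\<^sup>2 / 2 \<le> (norm y)\<^sup>2 + t\<^sup>2"
    using sum_squares_bound[of "norm y" t] by (simp add: power2_sum)
  then have "((norm y)\<^sup>2 + t\<^sup>2) powr (- ?p / 2) \<le> ((norm y + t)\<^sup>2 / 2) powr (- ?p / 2)"
    using \<alpha> t by (intro powr_mono2') (auto intro!: add_nonneg_pos less_imp_neq[symmetric])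
  also have "\<dots> = 2 powr (?p / 2) * (norm y + t) powr - ?p"
    using t by (intro powr_half_square_div) auto
  finally have "t powr \<alpha> * ((norm y)\<^sup>2 + t\<^sup>2) powr (- ?p / 2)
      \<le> (norm y + t) powr \<alpha> * (2 powr (?p / 2) * (norm y + t) powr - ?p)"
    using \<alpha> t by (intro mult_mono powr_mono2) auto
  also have "\<dots> = 2 powr (?p / 2) * ((norm y + t) powr \<alpha> * (norm y + t) powr - ?p)"
    by (simp only: mult_ac)
  also have "(norm y + t) powr \<alpha> * (norm y + t) powr - ?p = 1 / (norm y + t) ^ CARD('n)"
    using t by (subst powr_add[symmetric]) (simp add: powr_minus_divide powr_realpow add_nonneg_pos)
  finally have "poisson_const CARD('n) \<alpha> * (t powr \<alpha> * ((norm y)\<^sup>2 + t\<^sup>2) powr (- ?p / 2))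
    \<le> poisson_const CARD('n) \<alpha> * (2 powr (?p / 2) * (1 / (norm y + t) ^ CARD('n)))"
    using poisson_const_pos[OF \<alpha>, of "CARD('n)"] by (intro mult_left_mono) auto
  then show ?thesis
    by (simp add: poisson_kernel_def mult.assoc)
qed

text \<open>Split at |y| = t. Inside, the kernel is at most a constant times \<open>t^(-n)\<close>
  on a ball of volume of order \<open>t^n\<close>; outside, \<open>t^\<alpha>\<close> cancels the
  tail integral of order \<open>t^(-\<alpha>)\<close>. Neither part depends on t.\<close>

lemma nn_integral_poisson_kernel_le:
  fixes \<alpha> :: real
  assumes \<alpha>: "0 < \<alpha>"
  shows "\<exists>C>0. \<forall>t>0. \<forall>x :: real ^ 'n. (\<integral>\<^sup>+y. ennreal (poisson_kernel \<alpha> t (x - y)) \<partial>lborel) \<le> ennreal C"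
proof -
  let ?n = "CARD('n)"
  let ?c = "poisson_const ?n \<alpha>"
  let ?b = "?c * 2 powr ((?n + \<alpha>) / 2)"
  let ?v = "unit_ball_vol ?n"
  have c: "0 < ?c" using \<alpha> by (rule poisson_const_pos)
  obtain C1 where C1: "0 < C1" "\<And>R. 0 < R \<Longrightarrow> (\<integral>\<^sup>+h.
      ennreal (norm (h :: real ^ 'n) powr - (?n + \<alpha>)) * indicator {h. R \<le> norm h} h \<partial>lborel)
    \<le> ennreal (C1 * R powr -\<alpha>)"
    using nn_integral_norm_powr_outside[where 'a = "real ^ 'n", OF \<alpha>] by auto
  have "(\<integral>\<^sup>+y. ennreal (poisson_kernel \<alpha> t (x - y)) \<partial>lborel) \<le> ennreal (?b * ?v + ?c * C1)"
    if t: "0 < t" for t and x :: "real ^ 'n"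
  proof -
    have "(\<integral>\<^sup>+y. ennreal (poisson_kernel \<alpha> t (x - y)) \<partial>lborel)
      = (\<integral>\<^sup>+y. ennreal (poisson_kernel \<alpha> t (y :: real ^ 'n)) \<partial>lborel)"
      by (rule nn_integral_lborel_reflect[where f = "\<lambda>y. ennreal (poisson_kernel \<alpha> t y)"]) measurable
    also have "\<dots> \<le> (\<integral>\<^sup>+y. ennreal (?b / t ^ ?n) * indicator (ball 0 t) y + ennreal (?c * t powr \<alpha>) *
      (ennreal (norm (y :: real ^ 'n) powr - (?n + \<alpha>)) * indicator {h. t \<le> norm h} y) \<partial>lborel)"
    proof (intro nn_integral_mono)
      fix y :: "real ^ 'n"
      show "ennreal (poisson_kernel \<alpha> t y) \<le> ennreal (?b / t ^ ?n) * indicator (ball 0 t) y + ennreal (?c * t powr \<alpha>) *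
        (ennreal (norm y powr - (?n + \<alpha>)) * indicator {h. t \<le> norm h} y)"
      proof (cases "t \<le> norm y")
        case True
        with t have y0: "y \<noteq> 0" by auto
        show ?thesis
          using True poisson_kernel_le_outside[OF \<alpha> t, of y, OF y0] c t
          by (auto simp: ennreal_mult[symmetric] intro!: ennreal_leI)
      next
        case False
        have "poisson_kernel \<alpha> t y \<le> ?b / (norm y + t) ^ ?n"
          by (rule poisson_kernel_le_sum[OF \<alpha> t])
        also have "\<dots> \<le> ?b / t ^ ?n"
          using t c by (intro divide_left_mono power_mono mult_pos_pos) (auto simp: add_nonneg_pos)
        finally show ?thesis using False by (simp add: ennreal_leI)
      qed
    qed
    also have "\<dots> = ennreal (?b / t ^ ?n) * emeasure lborel (ball (0 :: real ^ 'n) t) + ennreal (?c * t powr \<alpha>) *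
      (\<integral>\<^sup>+y. ennreal (norm (y :: real ^ 'n) powr - (?n + \<alpha>)) * indicator {h. t \<le> norm h} y \<partial>lborel)"
      by (subst nn_integral_add, measurable, subst nn_integral_cmult, measurable, subst nn_integral_cmult_indicator, measurable)
    also have "\<dots> \<le> ennreal (?b / t ^ ?n) * emeasure lborel (ball (0 :: real ^ 'n) t) +
      ennreal (?c * t powr \<alpha>) * ennreal (C1 * t powr -\<alpha>)"
      by (intro add_mono mult_left_mono C1 t) auto
    also have "\<dots> = ennreal (?b * ?v) + ennreal (?c * C1)"
    proof -
      have "ennreal (?b / t ^ ?n) * emeasure lborel (ball (0 :: real ^ 'n) t) = ennreal (?b * ?v)"
        using t c by (simp add: emeasure_ball ennreal_mult[symmetric])
      moreover have "t powr \<alpha> * (C1 * t powr -\<alpha>) = C1"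
        using t by (simp add: powr_minus)
      ultimately show ?thesis
        using c C1 by (simp add: ennreal_mult[symmetric] mult.assoc)
    qed
    also have "\<dots> = ennreal (?b * ?v + ?c * C1)"
      using c C1 by (intro ennreal_plus[symmetric]) auto
    finally show ?thesis .
  qed
  moreover have "0 < ?b * ?v + ?c * C1" using c C1 by (intro add_pos_pos mult_pos_pos) auto
  ultimately show ?thesis by blast
qed

text \<open>Put R = |x - z| + t. The integral is at most a constant times \<open>(r / R)^n\<close>
  when R > 2r, and at most the total mass of the kernel otherwise, so one term of the series, with
  \<open>2^j\<close> comparable to \<open>R / r\<close>, suffices. The condition in the indicator
  places (x, t) in the tent over the ball about z of radius \<open>2 ^ Suc j * r\<close>.\<close>

lemma nn_integral_poisson_kernel_ball_le:
  fixes \<alpha> :: real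
  assumes \<alpha>: "0 < \<alpha>"
  shows "\<exists>C>0. \<forall>x z :: real ^ 'n. \<forall>t>0. \<forall>r>0.
    (\<integral>\<^sup>+y. ennreal (poisson_kernel \<alpha> t (x - y)) * indicator (ball z r) y \<partial>lborel)
    \<le> (\<Sum>j. ennreal (C * (1 / 2 ^ CARD('n)) ^ j) * indicator {j. dist x z + t \<le> 2 ^ Suc j * r} j)"
proof -
  let ?n = "CARD('n)"
  let ?b = "poisson_const ?n \<alpha> * 2 powr ((?n + \<alpha>) / 2)"
  let ?v = "unit_ball_vol ?n"
  have c: "0 < poisson_const ?n \<alpha>" using \<alpha> by (rule poisson_const_pos)
  then have b: "0 < ?b" by simp
  obtain C1 where C1: "0 < C1"
    "\<And>t x. 0 < t \<Longrightarrow> (\<integral>\<^sup>+y. ennreal (poisson_kernel \<alpha> t ((x :: real ^ 'n) - y)) \<partial>lborel) \<le> ennreal C1"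
    using nn_integral_poisson_kernel_le[where 'n = 'n, OF \<alpha>] by blast
  \<comment> \<open>The first summand serves the case \<open>R \<le> 2 * r\<close>, the second the
    remaining one.\<close>
  let ?C = "C1 + ?b * 2 ^ ?n * ?v"
  have v: "0 \<le> ?b * 2 ^ ?n * ?v" using c by (intro mult_nonneg_nonneg) auto
  have "(\<integral>\<^sup>+y. ennreal (poisson_kernel \<alpha> t (x - y)) * indicator (ball z r) y \<partial>lborel)
    \<le> (\<Sum>j. ennreal (?C * (1 / 2 ^ ?n) ^ j) * indicator {j. dist x z + t \<le> 2 ^ Suc j * r} j)"
    if t: "0 < t" and r: "0 < r" for x z :: "real ^ 'n" and t r
  proof -
    let ?I = "\<integral>\<^sup>+y. ennreal (poisson_kernel \<alpha> t (x - y)) * indicator (ball z r) y \<partial>lborel"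
    define R where "R = dist x z + t"
    have R: "0 < R" using t by (simp add: R_def add_nonneg_pos)
    have "\<exists>j. ?I \<le> ennreal (?C * (1 / 2 ^ ?n) ^ j) \<and> R \<le> 2 ^ Suc j * r"
    proof (cases "R \<le> 2 * r")
      case True
      have "?I \<le> (\<integral>\<^sup>+y. ennreal (poisson_kernel \<alpha> t (x - y)) \<partial>lborel)"
        by (intro nn_integral_mono) (auto simp: indicator_def)
      also have "\<dots> \<le> ennreal ?C"
        using order.trans[OF C1(2)[OF t] ennreal_leI[of C1 ?C]] v by simp
      finally show ?thesis using True by (intro exI[of _ 0]) simp
    next
      case False
      then have "1 \<le> R / r" using r by simp
      then obtain j :: nat where j: "2 ^ j \<le> R / r" "R / r < 2 ^ Suc j"
        by (rule dyadic_scale)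
      have "?I \<le> (\<integral>\<^sup>+y. ennreal (?b / (R / 2) ^ ?n) * indicator (ball z r) y \<partial>lborel)"
      proof (intro nn_integral_mono)
        fix y
        show "ennreal (poisson_kernel \<alpha> t (x - y)) * indicator (ball z r) y
          \<le> ennreal (?b / (R / 2) ^ ?n) * indicator (ball z r) y"
        proof (cases "y \<in> ball z r")
          case True
          have "dist x z \<le> dist x y + dist z y" by (rule dist_triangle2)
          \<comment> \<open>Here |x - y| + t > R - r, and r < R / 2 in this case.\<close>
          with True False have le: "R / 2 \<le> norm (x - y) + t"
            by (simp add: R_def dist_norm)
          have "poisson_kernel \<alpha> t (x - y) \<le> ?b / (norm (x - y) + t) ^ ?n"
            by (rule poisson_kernel_le_sum[OF \<alpha> t])
          also have "\<dots> \<le> ?b / (R / 2) ^ ?n"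
            using le R b t by (intro divide_left_mono power_mono mult_pos_pos zero_less_power) (auto simp: add_nonneg_pos)
          finally show ?thesis by (intro mult_right_mono ennreal_leI) auto
        qed simp
      qed
      also have "\<dots> = ennreal (?b / (R / 2) ^ ?n) * emeasure lborel (ball z r)"
        by (rule nn_integral_cmult_indicator) simp
      also have "\<dots> = ennreal (?b / (R / 2) ^ ?n * (?v * r ^ ?n))"
        using r R c by (simp add: emeasure_ball ennreal_mult[symmetric])
      also have "?b / (R / 2) ^ ?n * (?v * r ^ ?n) = ?b * 2 ^ ?n * ?v * (r / R) ^ ?n"
        by (simp add: power_divide)
      also have "ennreal \<dots> \<le> ennreal (?C * (1 / 2 ^ ?n) ^ j)"
      proof (intro ennreal_leI mult_mono)
        have "r / R \<le> 1 / 2 ^ j" using j(1) r R by (simp add: field_simps)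
        then have "(r / R) ^ ?n \<le> (1 / 2 ^ j) ^ ?n" using r R by (intro power_mono) auto
        then show "(r / R) ^ ?n \<le> (1 / 2 ^ ?n) ^ j"
          by (simp add: power_divide power_mult[symmetric] mult.commute)
      qed (use C1 v r R in auto)
      finally show ?thesis using j(2) r by (intro exI[of _ j]) (simp add: pos_divide_less_eq)
    qed
    then obtain j where j: "?I \<le> ennreal (?C * (1 / 2 ^ ?n) ^ j)" "R \<le> 2 ^ Suc j * r" by blast
    then have "?I \<le> ennreal (?C * (1 / 2 ^ ?n) ^ j) * indicator {j. dist x z + t \<le> 2 ^ Suc j * r} j"
      by (simp add: R_def)
    also have "\<dots> \<le> (\<Sum>j. ennreal (?C * (1 / 2 ^ ?n) ^ j) * indicator {j. dist x z + t \<le> 2 ^ Suc j * r} j)"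
      by (rule le_suminf_ennreal)
    finally show ?thesis .
  qed
  moreover have "0 < ?C" using C1 v by simp
  ultimately show ?thesis by blast
qed

subsection \<open>From tents to the embedding\<close>

text \<open>The exponent adds -2n from the two averages and n - \<beta> from the perimeter of a ball
  of radius \<open>2^k\<close>. Exchanging the sum over k with the integrals, a pair (z, w) is
  weighted by the tail of a geometric series, which \<open>nn_integral_dyadic_tail\<close> bounds by
  \<open>|z-w|^(-n-\<beta>)\<close>.\<close>

lemma nn_integral_local_osc_le:
  fixes \<beta> :: real
  assumes \<beta>: "0 < \<beta>"
  shows "\<exists>C>0. \<forall>f :: real ^ 'n \<Rightarrow> real. f \<in> borel_measurable borel \<longrightarrow>
    (\<integral>\<^sup>+k. ennreal ((2 powr real_of_int k) powr - (CARD('n) + \<beta>)) *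
        (\<integral>\<^sup>+z. local_osc f (4 * 2 powr real_of_int k) z \<partial>lborel) \<partial>count_space UNIV)
    \<le> ennreal C * sobolev_seminorm \<beta> f"
proof -
  let ?p = "CARD('n) + \<beta>"
  obtain C where C: "0 < C" "\<And>d. 0 < d \<Longrightarrow> (\<integral>\<^sup>+k. ennreal ((2 powr real_of_int k) powr - ?p) *
      indicator {k. d < 4 * 2 powr real_of_int k} k \<partial>count_space UNIV) \<le> ennreal (C * d powr - ?p)"
    using nn_integral_dyadic_tail[of ?p] \<beta> by auto
  have "(\<integral>\<^sup>+k. ennreal ((2 powr real_of_int k) powr - ?p) *
        (\<integral>\<^sup>+z. local_osc f (4 * 2 powr real_of_int k) z \<partial>lborel) \<partial>count_space UNIV)
    \<le> ennreal C * sobolev_seminorm \<beta> f"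
    if f [measurable]: "f \<in> borel_measurable borel" for f :: "real ^ 'n \<Rightarrow> real"
  proof -
    let ?r = "\<lambda>k. 2 powr real_of_int k"
    let ?u = "\<lambda>k. ennreal (?r k powr - ?p)"
    let ?d = "\<lambda>z w. ennreal \<bar>f z - f w\<bar>"
    have "(\<integral>\<^sup>+k. ?u k * (\<integral>\<^sup>+z. local_osc f (4 * ?r k) z \<partial>lborel) \<partial>count_space UNIV)
      = (\<integral>\<^sup>+k. (\<integral>\<^sup>+z. (\<integral>\<^sup>+w. ?u k * (indicator (ball z (4 * ?r k)) w * ?d z w) \<partial>lborel) \<partial>lborel) \<partial>count_space UNIV)"
      unfolding local_osc_def by (simp add: nn_integral_cmult)
    also have "\<dots> = (\<integral>\<^sup>+z. (\<integral>\<^sup>+k. (\<integral>\<^sup>+w. ?u k * (indicator (ball z (4 * ?r k)) w * ?d z w) \<partial>lborel) \<partial>count_space UNIV) \<partial>lborel)"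
      by (rule nn_integral_count_space_nn_integral[symmetric]) (simp, measurable)
    also have "\<dots> = (\<integral>\<^sup>+z. (\<integral>\<^sup>+w. (\<integral>\<^sup>+k. ?u k * (indicator (ball z (4 * ?r k)) w * ?d z w) \<partial>count_space UNIV) \<partial>lborel) \<partial>lborel)"
      by (intro nn_integral_cong nn_integral_count_space_nn_integral[symmetric]) (simp, measurable)
    also have "\<dots> \<le> (\<integral>\<^sup>+z. (\<integral>\<^sup>+w. ennreal C * (ennreal \<bar>f w - f z\<bar> * ennreal (norm (w - z) powr - ?p)) \<partial>lborel) \<partial>lborel)"
    proof (intro nn_integral_mono)
      fix z w
      show "(\<integral>\<^sup>+k. ?u k * (indicator (ball z (4 * ?r k)) w * ?d z w) \<partial>count_space UNIV)
        \<le> ennreal C * (ennreal \<bar>f w - f z\<bar> * ennreal (norm (w - z) powr - ?p))"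
      proof (cases "z = w")
        case False
        have "(\<integral>\<^sup>+k. ?u k * (indicator (ball z (4 * ?r k)) w * ?d z w) \<partial>count_space UNIV)
          = (\<integral>\<^sup>+k. ?u k * indicator {k. dist z w < 4 * ?r k} k \<partial>count_space UNIV) * ?d z w"
          by (subst nn_integral_multc[symmetric]) (auto simp: indicator_def intro!: nn_integral_cong)
        also have "\<dots> \<le> ennreal (C * dist z w powr - ?p) * ?d z w"
          using False by (intro mult_right_mono C) auto
        finally show ?thesis
          using C(1) by (simp add: ennreal_mult dist_norm norm_minus_commute abs_minus_commute mult_ac)
      qed simp
    qed
    also have "\<dots> = ennreal C * (\<integral>\<^sup>+z. (\<integral>\<^sup>+w. ennreal \<bar>f w - f z\<bar> * ennreal (norm (w - z) powr - ?p) \<partial>lborel) \<partial>lborel)"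
      by (simp add: nn_integral_cmult)
    also have "(\<integral>\<^sup>+z. (\<integral>\<^sup>+w. ennreal \<bar>f w - f z\<bar> * ennreal (norm (w - z) powr - ?p) \<partial>lborel) \<partial>lborel)
      = (\<integral>\<^sup>+z. (\<integral>\<^sup>+h. ennreal \<bar>f (z + h) - f z\<bar> * ennreal (norm (z + h - z) powr - ?p) \<partial>lborel) \<partial>lborel)"
    proof (rule nn_integral_cong)
      fix z
      show "(\<integral>\<^sup>+w. ennreal \<bar>f w - f z\<bar> * ennreal (norm (w - z) powr - ?p) \<partial>lborel)
        = (\<integral>\<^sup>+h. ennreal \<bar>f (z + h) - f z\<bar> * ennreal (norm (z + h - z) powr - ?p) \<partial>lborel)"
        by (rule nn_integral_lborel_shift[symmetric]) measurable
    qed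
    also have "\<dots> = (\<integral>\<^sup>+h. (\<integral>\<^sup>+z. ennreal \<bar>f (z + h) - f z\<bar> * ennreal (norm h powr - ?p) \<partial>lborel) \<partial>lborel)"
      by (subst lborel_pair.Fubini') auto
    also have "\<dots> = sobolev_seminorm \<beta> f"
      by (simp add: sobolev_seminorm_eq nn_integral_multc)
    finally show ?thesis .
  qed
  then show ?thesis using C(1) by blast
qed

lemma poisson_ext_le_osc:
  fixes \<alpha> :: real
  assumes \<alpha>: "0 < \<alpha>"
  shows "\<exists>C>0. \<forall>(f :: real ^ 'n \<Rightarrow> real) x t. 0 < t \<longrightarrow> continuous_on UNIV f \<longrightarrow> integrable lborel f \<longrightarrow>
    ennreal \<bar>poisson_ext \<alpha> f (x, t)\<bar> \<le> (\<integral>\<^sup>+k. \<integral>\<^sup>+j. \<integral>\<^sup>+z.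
      ennreal (C * (2 powr real_of_int k) powr - (2 * CARD('n)) * (1 / 2 ^ CARD('n)) ^ j) *
      local_osc f (4 * 2 powr real_of_int k) z *
      indicator {z. dist x z + t \<le> 2 ^ Suc j * 2 powr real_of_int k} z
      \<partial>lborel \<partial>count_space UNIV \<partial>count_space UNIV)"
proof -
  let ?n = "CARD('n)"
  obtain C where C: "0 < C" "\<And>(x :: real ^ 'n) z t r. 0 < t \<Longrightarrow> 0 < r \<Longrightarrow>
    (\<integral>\<^sup>+y. ennreal (poisson_kernel \<alpha> t (x - y)) * indicator (ball z r) y \<partial>lborel)
    \<le> (\<Sum>j. ennreal (C * (1 / 2 ^ CARD('n)) ^ j) * indicator {j. dist x z + t \<le> 2 ^ Suc j * r} j)"
    using nn_integral_poisson_kernel_ball_le[where 'n = 'n, OF \<alpha>] by blast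
  define c where "c = 1 / ((unit_ball_vol ?n)\<^sup>2 * 2 ^ ?n)"
  have c: "0 < c" unfolding c_def by (intro divide_pos_pos mult_pos_pos zero_less_power) auto
  have "ennreal \<bar>poisson_ext \<alpha> f (x, t)\<bar> \<le> (\<integral>\<^sup>+k. \<integral>\<^sup>+j. \<integral>\<^sup>+z.
      ennreal (c * C * (2 powr real_of_int k) powr - (2 * ?n) * (1 / 2 ^ ?n) ^ j) *
      local_osc f (4 * 2 powr real_of_int k) z *
      indicator {z. dist x z + t \<le> 2 ^ Suc j * 2 powr real_of_int k} z
      \<partial>lborel \<partial>count_space UNIV \<partial>count_space UNIV)"
    if t: "0 < t" and cont: "continuous_on UNIV f" and int: "integrable lborel f"
    for f :: "real ^ 'n \<Rightarrow> real" and x t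
  proof -
    have [measurable]: "f \<in> borel_measurable borel" using int by auto
    let ?r = "\<lambda>k. 2 powr real_of_int k"
    let ?u = "\<lambda>k. ennreal (c * ?r k powr - (2 * ?n))"
    let ?O = "\<lambda>k. local_osc f (4 * ?r k)"
    let ?K = "\<lambda>y. ennreal (poisson_kernel \<alpha> t (x - y))"
    \<comment> \<open>This holds without proving integrability first: a Bochner integral that does
      not exist has the value 0.\<close>
    have "ennreal \<bar>poisson_ext \<alpha> f (x, t)\<bar> \<le> (\<integral>\<^sup>+y. ennreal (norm (poisson_kernel \<alpha> t (x - y) * f y)) \<partial>lborel)"
      using integral_norm_bound_ennreal[of lborel "\<lambda>y. poisson_kernel \<alpha> t (x - y) * f y"]
      by (cases "integrable lborel (\<lambda>y. poisson_kernel \<alpha> t (x - y) * f y)")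
        (simp_all add: poisson_ext_def not_integrable_integral_eq)
    also have "\<dots> = (\<integral>\<^sup>+y. ?K y * ennreal \<bar>f y\<bar> \<partial>lborel)"
      by (intro nn_integral_cong) (simp add: abs_mult ennreal_mult poisson_kernel_nonneg[OF \<alpha>])
    also have "\<dots> \<le> (\<integral>\<^sup>+y. ?K y * (\<integral>\<^sup>+k. ?u k * (\<integral>\<^sup>+z. indicator (ball z (?r k)) y * ?O k z \<partial>lborel) \<partial>count_space UNIV) \<partial>lborel)"
    proof (intro nn_integral_mono mult_left_mono)
      fix y
      have "isCont f y" using cont by (simp add: continuous_on_eq_continuous_at)
      from abs_le_dyadic_osc[OF int this]
      show "ennreal \<bar>f y\<bar> \<le> (\<integral>\<^sup>+k. ?u k * (\<integral>\<^sup>+z. indicator (ball z (?r k)) y * ?O k z \<partial>lborel) \<partial>count_space UNIV)"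
        by (simp add: c_def)
    qed auto
    also have "\<dots> = (\<integral>\<^sup>+y. (\<integral>\<^sup>+k. ?K y * (?u k * (\<integral>\<^sup>+z. indicator (ball z (?r k)) y * ?O k z \<partial>lborel)) \<partial>count_space UNIV) \<partial>lborel)"
      by (subst nn_integral_cmult) auto
    also have "\<dots> = (\<integral>\<^sup>+k. (\<integral>\<^sup>+y. ?K y * (?u k * (\<integral>\<^sup>+z. indicator (ball z (?r k)) y * ?O k z \<partial>lborel)) \<partial>lborel) \<partial>count_space UNIV)"
      by (rule nn_integral_count_space_nn_integral) (simp, measurable)
    also have "\<dots> \<le> (\<integral>\<^sup>+k. \<integral>\<^sup>+j. \<integral>\<^sup>+z.
      ennreal (c * C * ?r k powr - (2 * ?n) * (1 / 2 ^ ?n) ^ j) * ?O k z *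
      indicator {z. dist x z + t \<le> 2 ^ Suc j * ?r k} z
      \<partial>lborel \<partial>count_space UNIV \<partial>count_space UNIV)"
    proof (intro nn_integral_mono)
      fix k
      let ?J = "\<lambda>j z. ennreal (C * (1 / 2 ^ ?n) ^ j) * indicator {j. dist x z + t \<le> 2 ^ Suc j * ?r k} j"
      have "(\<integral>\<^sup>+y. ?K y * (?u k * (\<integral>\<^sup>+z. indicator (ball z (?r k)) y * ?O k z \<partial>lborel)) \<partial>lborel)
        = (\<integral>\<^sup>+y. (\<integral>\<^sup>+z. ?u k * ?O k z * (?K y * indicator (ball z (?r k)) y) \<partial>lborel) \<partial>lborel)"
        by (simp add: nn_integral_cmult[symmetric] mult_ac)
      also have "\<dots> = (\<integral>\<^sup>+z. (\<integral>\<^sup>+y. ?u k * ?O k z * (?K y * indicator (ball z (?r k)) y) \<partial>lborel) \<partial>lborel)"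
        by (rule lborel_pair.Fubini') measurable
      also have "\<dots> = (\<integral>\<^sup>+z. ?u k * ?O k z * (\<integral>\<^sup>+y. ?K y * indicator (ball z (?r k)) y \<partial>lborel) \<partial>lborel)"
        by (subst nn_integral_cmult) auto
      also have "\<dots> \<le> (\<integral>\<^sup>+z. ?u k * ?O k z * (\<Sum>j. ?J j z) \<partial>lborel)"
        by (intro nn_integral_mono mult_left_mono C t) auto
      also have "\<dots> = (\<integral>\<^sup>+z. (\<integral>\<^sup>+j. ?u k * ?O k z * ?J j z \<partial>count_space UNIV) \<partial>lborel)"
        by (subst nn_integral_cmult) (simp_all add: nn_integral_count_space_nat)
      also have "\<dots> = (\<integral>\<^sup>+j. (\<integral>\<^sup>+z. ?u k * ?O k z * ?J j z \<partial>lborel) \<partial>count_space UNIV)"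
      proof (rule nn_integral_count_space_nn_integral)
        fix j :: nat
        \<comment> \<open>The same condition is read as a set of centres z instead of a set of
          indices j, which makes its measurability in z visible.\<close>
        have eq: "indicator {j. dist x z + t \<le> 2 ^ Suc j * ?r k} j = (indicator {z. dist x z + t \<le> 2 ^ Suc j * ?r k} z :: ennreal)" for z
          by (simp add: indicator_def)
        show "(\<lambda>z. ?u k * ?O k z * ?J j z) \<in> borel_measurable lborel"
          unfolding eq by measurable
      qed simp
      also have "\<dots> = (\<integral>\<^sup>+j. (\<integral>\<^sup>+z. ennreal (c * C * ?r k powr - (2 * ?n) * (1 / 2 ^ ?n) ^ j) * ?O k z *
        indicator {z. dist x z + t \<le> 2 ^ Suc j * ?r k} z \<partial>lborel) \<partial>count_space UNIV)"
        using c C(1) by (intro nn_integral_cong) (simp add: ennreal_mult indicator_def mult_ac)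
      finally show "(\<integral>\<^sup>+y. ?K y * (?u k * (\<integral>\<^sup>+z. indicator (ball z (?r k)) y * ?O k z \<partial>lborel)) \<partial>lborel) \<le> \<dots>" .
    qed
    finally show ?thesis .
  qed
  then show ?thesis using c C(1) mult_pos_pos by blast
qed

section \<open>Test functions, and Radon measures on the half space\<close>

lemma test_function_continuous: "f \<in> test_functions \<Longrightarrow> continuous_on UNIV f"
  unfolding test_functions_def by (auto dest: spec[of _ 0])

lemma integrable_continuous_compact_support:
  fixes f :: "'a::euclidean_space \<Rightarrow> real"
  assumes cont: "continuous_on UNIV f" and supp: "compact (closure {x. f x \<noteq> 0})"
  shows "integrable lborel f"
proof -
  let ?K = "closure {x. f x \<noteq> 0}"
  have "integrable lborel (\<lambda>x. indicator ?K x *\<^sub>R f x)"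
    using borel_integrable_compact[OF supp] cont continuous_on_subset by blast
  also have "(\<lambda>x. indicator ?K x *\<^sub>R f x) = f"
    using closure_subset[of "{x. f x \<noteq> 0}"] by (intro ext) (auto simp: indicator_def)
  finally show ?thesis .
qed

lemma test_function_integrable: "f \<in> test_functions \<Longrightarrow> integrable lborel f"
  for f :: "'a::euclidean_space \<Rightarrow> real"
  by (rule integrable_continuous_compact_support)
    (auto simp: test_function_continuous, simp add: test_functions_def)

lemma half_space_open: "open (half_space :: ((real ^ 'n) \<times> real) set)"
proof -
  have eq: "(half_space :: ((real ^ 'n) \<times> real) set) = snd -` {0<..}"
    by (auto simp: half_space_def)
  show ?thesis unfolding eq by (intro open_vimage_snd open_greaterThan)
qed

lemma radon_space:
  assumes "radon_measure_on half_space \<mu>"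
  shows "space \<mu> = half_space" "sets \<mu> = sets (restrict_space borel half_space)"
proof -
  show s: "sets \<mu> = sets (restrict_space borel half_space)"
    using assms by (simp add: radon_measure_on_def)
  show "space \<mu> = half_space"
    using sets_eq_imp_space_eq[OF s] by (simp add: space_restrict_space)
qed

lemma radon_sets:
  assumes "radon_measure_on half_space \<mu>" "A \<in> sets borel" "A \<subseteq> half_space"
  shows "A \<in> sets \<mu>"
  using assms(2,3) by (auto simp: radon_space(2)[OF assms(1)] sets_restrict_space)

lemma radon_measurable:
  assumes "radon_measure_on half_space \<mu>" "f \<in> borel_measurable borel"
  shows "f \<in> borel_measurable \<mu>"
  using measurable_restrict_space1[OF assms(2), of half_space]
  by (simp add: measurable_cong_sets[OF radon_space(2)[OF assms(1)] refl])

text \<open>Required for Fubini in \<open>Minkowski_integral_indicator\<close>. The half space is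
  exhausted by compact boxes that stay away from t = 0, and each has finite measure.\<close>

lemma radon_sigma_finite:
  fixes \<mu> :: "((real ^ 'n) \<times> real) measure"
  assumes R: "radon_measure_on half_space \<mu>"
  shows "sigma_finite_measure \<mu>"
proof
  define K where "K m = cball (0 :: real ^ 'n) (real m) \<times> {1 / real (Suc m)..real m}" for m :: nat
  have K: "compact (K m)" "K m \<subseteq> half_space" for m
  proof -
    have "0 < 1 / real (Suc m)" by simp
    from less_le_trans[OF this] show "K m \<subseteq> half_space"
      unfolding K_def half_space_def by auto
  qed (simp add: K_def compact_Times)
  have "\<Union> (range K) = half_space"
  proof
    show "half_space \<subseteq> \<Union> (range K)"
    proof
      fix p :: "(real ^ 'n) \<times> real" assume "p \<in> half_space"
      then obtain x t where p: "p = (x, t)" "0 < t" by (cases p) (auto simp: half_space_def)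
      obtain m1 :: nat where m1: "norm x \<le> m1" using real_arch_simple by blast
      obtain m2 :: nat where m2: "t \<le> m2" using real_arch_simple by blast
      obtain m3 :: nat where m3: "1 / real (Suc m3) < t"
        using reals_Archimedean[OF p(2)] by (auto simp: inverse_eq_divide)
      define m where "m = max m1 (max m2 m3)"
      have "1 / real (Suc m) \<le> 1 / real (Suc m3)" by (simp add: m_def frac_le)
      moreover have "real m1 \<le> real m" "real m2 \<le> real m" by (simp_all add: m_def)
      ultimately have "p \<in> K m" using m1 m2 m3 by (simp add: K_def p)
      then show "p \<in> \<Union> (range K)" by blast
    qed
  qed (use K in blast)
  moreover have "K m \<in> sets \<mu>" for m
    using K[of m] by (intro radon_sets[OF R]) (auto intro: borel_compact)
  moreover have "emeasure \<mu> (K m) < \<infinity>" for m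
    using R K[of m] by (auto simp: radon_measure_on_def)
  ultimately show "\<exists>A. countable A \<and> A \<subseteq> sets \<mu> \<and> \<Union> A = space \<mu> \<and> (\<forall>a\<in>A. emeasure \<mu> a \<noteq> \<infinity>)"
    by (intro exI[of _ "range K"]) (auto simp: radon_space(1)[OF R] less_top[symmetric])
qed

text \<open>A tent is relatively closed: its complement in the half space is the union over y
  outside U of the open cones dist(x, y) < t.\<close>

lemma tent_borel: "tent U \<in> sets borel" and tent_subset: "tent U \<subseteq> half_space"
  for U :: "(real ^ 'n) set"
proof -
  have "tent U = half_space - (\<Union>y\<in>-U. {p. dist (fst p) y < snd p})"
    by (auto simp: tent_def half_space_def subset_eq)
  moreover have "open (\<Union>y\<in>-U. {p. dist (fst p) y < snd p} :: ((real ^ 'n) \<times> real) set)"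
    by (intro open_UN ballI open_Collect_less continuous_intros)
  ultimately show "tent U \<in> sets borel"
    using half_space_open[where 'n = 'n] by (simp add: borel_open sets.Diff)
  show "tent U \<subseteq> half_space" by (auto simp: tent_def half_space_def)
qed

proposition trace_inequality_if_tent_inequality:
  fixes \<alpha> \<beta> q :: real and \<mu> :: "((real ^ 'n) \<times> real) measure"
  assumes \<alpha>: "0 < \<alpha>" and \<beta>: "0 < \<beta>" "\<beta> < 1" and q: "1 \<le> q"
    and R: "radon_measure_on half_space \<mu>"
    and C': "C' < \<infinity>" "\<And>U. open U \<Longrightarrow> bounded U \<Longrightarrow>
      epowr (emeasure \<mu> (tent U)) (1 / q) \<le> C' * fractional_perimeter \<beta> U"
  shows "\<exists>C::ennreal. C < \<infinity> \<and>
    (\<forall>f\<in>test_functions. Lq_norm \<mu> q (poisson_ext \<alpha> f) \<le> C * sobolev_seminorm \<beta> f)"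
proof -
  let ?n = "CARD('n)"
  obtain c' where c': "0 \<le> c'" "C' = ennreal c'" using C'(1) by (cases C' rule: ennreal_cases) auto
  obtain P where P: "0 < P" "\<And>R (a :: real ^ 'n). 0 < R \<Longrightarrow>
      fractional_perimeter \<beta> (ball a R) \<le> ennreal (P * R powr (?n - \<beta>))"
    using fractional_perimeter_ball_le[where 'n = 'n, OF \<beta>] by blast
  obtain A where A: "0 < A" "\<And>(f :: real ^ 'n \<Rightarrow> real) x t. 0 < t \<Longrightarrow> continuous_on UNIV f \<Longrightarrow> integrable lborel f \<Longrightarrow>
    ennreal \<bar>poisson_ext \<alpha> f (x, t)\<bar> \<le> (\<integral>\<^sup>+k. \<integral>\<^sup>+j. \<integral>\<^sup>+z.
      ennreal (A * (2 powr real_of_int k) powr - (2 * ?n) * (1 / 2 ^ ?n) ^ j) *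
      local_osc f (4 * 2 powr real_of_int k) z *
      indicator {z. dist x z + t \<le> 2 ^ Suc j * 2 powr real_of_int k} z
      \<partial>lborel \<partial>count_space UNIV \<partial>count_space UNIV)"
    using poisson_ext_le_osc[where 'n = 'n, OF \<alpha>] by blast
  obtain B where B: "0 < B" "\<And>f :: real ^ 'n \<Rightarrow> real. f \<in> borel_measurable borel \<Longrightarrow>
    (\<integral>\<^sup>+k. ennreal ((2 powr real_of_int k) powr - (?n + \<beta>)) *
        (\<integral>\<^sup>+z. local_osc f (4 * 2 powr real_of_int k) z \<partial>lborel) \<partial>count_space UNIV)
    \<le> ennreal B * sobolev_seminorm \<beta> f"
    using nn_integral_local_osc_le[where 'n = 'n, OF \<beta>(1)] by blast
  \<comment> \<open>The 1 keeps D, and so every \<open>a kj\<close>, strictly positive even when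
    \<open>c' = 0\<close>; Minkowski's inequality is stated for positive norms.\<close>
  define D where "D = (c' + 1) * P"
  have D: "0 < D" using c' P by (simp add: D_def)
  define r where "r = (\<lambda>kj :: int \<times> nat. 2 ^ Suc (snd kj) * 2 powr real_of_int (fst kj))"
  have r: "0 < r kj" for kj by (simp add: r_def)
  define w where "w = (\<lambda>kj :: int \<times> nat. A * (2 powr real_of_int (fst kj)) powr - (2 * ?n) * (1 / 2 ^ ?n) ^ snd kj)"
  define a where "a = (\<lambda>kj. D * r kj powr (?n - \<beta>))"
  \<comment> \<open>An index \<open>((k, j), z)\<close> stands for the ball about \<open>z\<close> of radius \<open>2\<^sup>k\<close>, dilated by \<open>2\<^sup>j\<^sup>+\<^sup>1\<close>.\<close>
  let ?\<nu> = "count_space UNIV \<Otimes>\<^sub>M lborel :: ((int \<times> nat) \<times> (real ^ 'n)) measure"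
  define S :: "(((real ^ 'n) \<times> real) \<times> ((int \<times> nat) \<times> (real ^ 'n))) set"
    where "S = {p \<in> space (\<mu> \<Otimes>\<^sub>M ?\<nu>). dist (fst (fst p)) (snd (snd p)) + snd (fst p) \<le> r (fst (snd p))}"
  have [measurable]: "fst \<in> borel_measurable \<mu>" "snd \<in> borel_measurable \<mu>"
    by (auto intro!: radon_measurable[OF R] simp: borel_prod[symmetric])
  have [measurable]: "r \<in> borel_measurable (count_space UNIV)" "a \<in> borel_measurable (count_space UNIV)"
    by auto
  have S: "S \<in> sets (\<mu> \<Otimes>\<^sub>M ?\<nu>)"
    unfolding S_def by measurable
  \<comment> \<open>If |x - z| + t \<le> r then B(x, t) lies in B(z, r), so a section of S is
    contained in the tent over a ball. There the hypothesis and the perimeter bound apply, and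
    raising to the power q removes the root.\<close>
  have tent: "emeasure \<mu> {\<xi>\<in>space \<mu>. (\<xi>, i) \<in> S} \<le> ennreal (a (fst i) powr q)" for i
  proof -
    obtain kj z where i: "i = (kj, z)" by (cases i)
    have sub: "{\<xi>\<in>space \<mu>. (\<xi>, i) \<in> S} \<subseteq> tent (ball z (r kj))"
    proof
      fix \<xi> assume \<xi>: "\<xi> \<in> {\<xi>\<in>space \<mu>. (\<xi>, i) \<in> S}"
      obtain x t where xt: "\<xi> = (x, t)" by (cases \<xi>)
      with \<xi> have "0 < t" "dist x z + t \<le> r kj"
        by (auto simp: S_def i radon_space[OF R] half_space_def)
      moreover from this have "dist z y < r kj" if "dist x y < t" for y
        using dist_triangle3[of z y x] that by linarith
      ultimately show "\<xi> \<in> tent (ball z (r kj))"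
        unfolding xt tent_def by auto
    qed
    let ?m = "emeasure \<mu> (tent (ball z (r kj)))"
    have "epowr ?m (1 / q) \<le> C' * fractional_perimeter \<beta> (ball z (r kj))"
      by (rule C'(2)) auto
    also have "\<dots> \<le> ennreal (c' + 1) * ennreal (P * r kj powr (?n - \<beta>))"
      using c' by (intro mult_mono P r) (auto intro: ennreal_leI)
    also have "\<dots> = ennreal (a kj)"
      unfolding a_def D_def mult.assoc using c' P(1) by (intro ennreal_mult[symmetric]) auto
    finally have "epowr (epowr ?m (1 / q)) q \<le> epowr (ennreal (a kj)) q"
      using q by (intro epowr_mono) auto
    then have "?m \<le> ennreal (a kj powr q)"
      using epowr_epowr_inverse[of "1 / q" ?m] q D by (simp add: epowr_ennreal a_def)
    moreover have "emeasure \<mu> {\<xi>\<in>space \<mu>. (\<xi>, i) \<in> S} \<le> ?m"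
      using sub by (intro emeasure_mono radon_sets[OF R] tent_borel tent_subset)
    ultimately show ?thesis by (simp add: i)
  qed
  let ?s = "2 powr -\<beta>"
  have s: "0 < ?s" "?s < 1" using \<beta> powr_less_mono[of "-\<beta>" 0 2] by auto
  \<comment> \<open>The factor \<open>2 powr (?n - \<beta>)\<close> stems from the extra doubling
    \<open>Suc j\<close> in the radius, and \<open>1 / (1 - ?s)\<close> is the geometric sum over
    j.\<close>
  define E where "E = A * D * 2 powr (?n - \<beta>) * (1 / (1 - ?s))"
  have E: "0 < E" unfolding E_def using A(1) D s by (intro mult_pos_pos divide_pos_pos) auto
  have "Lq_norm \<mu> q (poisson_ext \<alpha> f) \<le> ennreal (E * B) * sobolev_seminorm \<beta> f"
    if "f \<in> test_functions" for f :: "real ^ 'n \<Rightarrow> real"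
  proof -
    have cont: "continuous_on UNIV f" and int: "integrable lborel f"
      using that by (auto intro: test_function_continuous test_function_integrable)
    then have [measurable]: "f \<in> borel_measurable borel" by auto
    let ?O = "\<lambda>k. local_osc f (4 * 2 powr real_of_int k)"
    define g where "g = (\<lambda>i :: (int \<times> nat) \<times> (real ^ 'n). ennreal (w (fst i)) * ?O (fst (fst i)) (snd i))"
    have g [measurable]: "g \<in> borel_measurable ?\<nu>"
      unfolding g_def by (intro measurable_pair_measure_countable1) auto
    have iterated: "(\<integral>\<^sup>+i. h i \<partial>?\<nu>)
      = (\<integral>\<^sup>+k. \<integral>\<^sup>+j. \<integral>\<^sup>+z. h ((k, j), z) \<partial>lborel \<partial>count_space UNIV \<partial>count_space UNIV)"
      if h: "h \<in> borel_measurable ?\<nu>" for h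
      by (subst lborel.nn_integral_fst[OF h, symmetric]) (rule nn_integral_fst_count_space[symmetric])
    have bound: "ennreal \<bar>poisson_ext \<alpha> f \<xi>\<bar> \<le> (\<integral>\<^sup>+i. g i * indicator S (\<xi>, i) \<partial>?\<nu>)"
      if \<xi>: "\<xi> \<in> space \<mu>" for \<xi>
    proof -
      obtain x t where xt: "\<xi> = (x, t)" by (cases \<xi>)
      with \<xi> have t: "0 < t" by (simp add: radon_space[OF R] half_space_def)
      have [measurable]: "(\<lambda>i. indicator S (\<xi>, i) :: ennreal) \<in> borel_measurable ?\<nu>"
        using S \<xi> by measurable
      have "(\<integral>\<^sup>+i. g i * indicator S (\<xi>, i) \<partial>?\<nu>) = (\<integral>\<^sup>+k. \<integral>\<^sup>+j. \<integral>\<^sup>+z.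
          g ((k, j), z) * indicator S (\<xi>, ((k, j), z)) \<partial>lborel \<partial>count_space UNIV \<partial>count_space UNIV)"
        by (rule iterated) measurable
      also have "\<dots> = (\<integral>\<^sup>+k. \<integral>\<^sup>+j. \<integral>\<^sup>+z.
        ennreal (A * (2 powr real_of_int k) powr - (2 * ?n) * (1 / 2 ^ ?n) ^ j) * ?O k z *
        indicator {z. dist x z + t \<le> 2 ^ Suc j * 2 powr real_of_int k} z
        \<partial>lborel \<partial>count_space UNIV \<partial>count_space UNIV)"
        using \<xi> by (intro nn_integral_cong)
          (auto simp: g_def w_def S_def r_def xt space_pair_measure indicator_def)
      finally show ?thesis using A(2)[OF t cont int, of x] by (simp only: xt)
    qed
    have total: "(\<integral>\<^sup>+i. g i * ennreal (a (fst i)) \<partial>?\<nu>) \<le> ennreal (E * B) * sobolev_seminorm \<beta> f"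
    proof -
      have coeff: "w (k, j) * a (k, j)
        = A * D * 2 powr (?n - \<beta>) * ?s ^ j * (2 powr real_of_int k) powr - (?n + \<beta>)" for k j
      proof -
        let ?r = "2 powr real_of_int k"
        have "r (k, j) powr (?n - \<beta>) = 2 powr (?n - \<beta>) * (2 ^ j) powr (?n - \<beta>) * ?r powr (?n - \<beta>)"
          by (simp add: r_def powr_mult)
        also have "(2 ^ j) powr (?n - \<beta>) = (2 ^ ?n) ^ j * ?s ^ j"
          by (simp add: powr_realpow[symmetric] powr_powr powr_add[symmetric] algebra_simps)
        finally have "w (k, j) * a (k, j) = A * D * 2 powr (?n - \<beta>) * ?s ^ j *
          ((1 / 2 ^ ?n) ^ j * (2 ^ ?n) ^ j) * (?r powr - (2 * ?n) * ?r powr (?n - \<beta>))"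
          by (simp add: w_def a_def)
        moreover have "(1 / 2 ^ ?n) ^ j * (2 ^ ?n :: real) ^ j = 1"
          by (simp add: power_mult_distrib[symmetric])
        moreover have "?r powr - (2 * ?n) * ?r powr (?n - \<beta>) = ?r powr - (?n + \<beta>)"
          by (subst powr_add[symmetric]) simp
        ultimately show ?thesis by simp
      qed
      have sum_j: "(\<integral>\<^sup>+j. ennreal (w (k, j) * a (k, j)) \<partial>count_space UNIV)
        = ennreal (E * (2 powr real_of_int k) powr - (?n + \<beta>))" for k
      proof -
        have "(\<lambda>j. w (k, j) * a (k, j)) sums (E * (2 powr real_of_int k) powr - (?n + \<beta>))"
          unfolding coeff E_def
          by (intro sums_mult2 sums_mult geometric_sums) (use s in auto)
        moreover have "0 \<le> w (k, j) * a (k, j)" for j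
          using A(1) D by (simp add: w_def a_def)
        ultimately show ?thesis
          by (simp only: nn_integral_count_space_nat suminf_ennreal_eq)
      qed
      have m: "(\<lambda>i. g i * ennreal (a (fst i))) \<in> borel_measurable ?\<nu>"
        by measurable
      have "(\<integral>\<^sup>+i. g i * ennreal (a (fst i)) \<partial>?\<nu>)
        = (\<integral>\<^sup>+k. \<integral>\<^sup>+j. \<integral>\<^sup>+z. g ((k, j), z) * ennreal (a (k, j)) \<partial>lborel \<partial>count_space UNIV \<partial>count_space UNIV)"
        by (simp only: iterated[OF m] fst_conv)
      also have "\<dots> = (\<integral>\<^sup>+k. \<integral>\<^sup>+j. ennreal (w (k, j) * a (k, j)) * (\<integral>\<^sup>+z. ?O k z \<partial>lborel) \<partial>count_space UNIV \<partial>count_space UNIV)"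
      proof (rule nn_integral_cong, rule nn_integral_cong)
        fix k :: int and j :: nat
        have w0: "0 \<le> w (k, j)" "0 \<le> a (k, j)" using A(1) D by (simp_all add: w_def a_def)
        have "(\<integral>\<^sup>+z. g ((k, j), z) * ennreal (a (k, j)) \<partial>lborel)
          = (\<integral>\<^sup>+z. ennreal (w (k, j) * a (k, j)) * ?O k z \<partial>lborel)"
          using w0 by (intro nn_integral_cong) (simp add: g_def ennreal_mult mult_ac)
        also have "\<dots> = ennreal (w (k, j) * a (k, j)) * (\<integral>\<^sup>+z. ?O k z \<partial>lborel)"
          by (rule nn_integral_cmult) measurable
        finally show "(\<integral>\<^sup>+z. g ((k, j), z) * ennreal (a (k, j)) \<partial>lborel)
          = ennreal (w (k, j) * a (k, j)) * (\<integral>\<^sup>+z. ?O k z \<partial>lborel)" .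
      qed
      also have "\<dots> = (\<integral>\<^sup>+k. ennreal E * (ennreal ((2 powr real_of_int k) powr - (?n + \<beta>)) *
          (\<integral>\<^sup>+z. ?O k z \<partial>lborel)) \<partial>count_space UNIV)"
      proof (rule nn_integral_cong)
        fix k :: int
        have "(\<integral>\<^sup>+j. ennreal (w (k, j) * a (k, j)) * (\<integral>\<^sup>+z. ?O k z \<partial>lborel) \<partial>count_space UNIV)
          = (\<integral>\<^sup>+j. ennreal (w (k, j) * a (k, j)) \<partial>count_space UNIV) * (\<integral>\<^sup>+z. ?O k z \<partial>lborel)"
          by (rule nn_integral_multc) simp
        also have "\<dots> = ennreal E * (ennreal ((2 powr real_of_int k) powr - (?n + \<beta>)) * (\<integral>\<^sup>+z. ?O k z \<partial>lborel))"
          unfolding sum_j using E by (simp only: ennreal_mult less_imp_le powr_ge_zero mult.assoc)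
        finally show "(\<integral>\<^sup>+j. ennreal (w (k, j) * a (k, j)) * (\<integral>\<^sup>+z. ?O k z \<partial>lborel) \<partial>count_space UNIV)
          = ennreal E * (ennreal ((2 powr real_of_int k) powr - (?n + \<beta>)) * (\<integral>\<^sup>+z. ?O k z \<partial>lborel))" .
      qed
      also have "\<dots> \<le> ennreal E * (ennreal B * sobolev_seminorm \<beta> f)"
        by (subst nn_integral_cmult, simp, intro mult_left_mono B(2)) simp_all
      finally show ?thesis using E B(1) by (simp add: ennreal_mult mult.assoc)
    qed
    have "(\<integral>\<^sup>+\<xi>. ennreal (\<bar>poisson_ext \<alpha> f \<xi>\<bar> powr q) \<partial>\<mu>)
      \<le> (\<integral>\<^sup>+\<xi>. epowr (\<integral>\<^sup>+i. g i * indicator S (\<xi>, i) \<partial>?\<nu>) q \<partial>\<mu>)"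
    proof (intro nn_integral_mono)
      fix \<xi> assume "\<xi> \<in> space \<mu>"
      then have "epowr (ennreal \<bar>poisson_ext \<alpha> f \<xi>\<bar>) q \<le> epowr (\<integral>\<^sup>+i. g i * indicator S (\<xi>, i) \<partial>?\<nu>) q"
        using q by (intro epowr_mono bound) auto
      then show "ennreal (\<bar>poisson_ext \<alpha> f \<xi>\<bar> powr q) \<le> epowr (\<integral>\<^sup>+i. g i * indicator S (\<xi>, i) \<partial>?\<nu>) q"
        by (simp add: epowr_ennreal)
    qed
    also have "\<dots> \<le> epowr (\<integral>\<^sup>+i. g i * ennreal (a (fst i)) \<partial>?\<nu>) q"
    proof (rule Minkowski_integral_indicator)
      show "sigma_finite_measure ?\<nu>"
      proof -
        interpret pair_sigma_finite "count_space (UNIV :: (int \<times> nat) set)" "lborel :: (real ^ 'n) measure"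
          by (intro pair_sigma_finite.intro sigma_finite_measure_count_space sigma_finite_lborel)
        show ?thesis by (rule P.sigma_finite_measure_axioms)
      qed
      show "0 < a (fst i)" for i using D r[of "fst i"] by (simp add: a_def)
    qed (use q in \<open>simp_all add: S tent radon_sigma_finite[OF R] del: powr_gt_zero\<close>)
    finally have "Lq_norm \<mu> q (poisson_ext \<alpha> f) \<le> epowr (epowr (\<integral>\<^sup>+i. g i * ennreal (a (fst i)) \<partial>?\<nu>) q) (1 / q)"
      unfolding Lq_norm_def using q by (intro epowr_mono) auto
    also have "\<dots> = (\<integral>\<^sup>+i. g i * ennreal (a (fst i)) \<partial>?\<nu>)"
      using q by (intro epowr_epowr_inverse) auto
    finally show ?thesis using total by (rule order.trans)
  qed
  then show ?thesis by (intro exI[of _ "ennreal (E * B)"]) auto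
qed

subsection \<open>Smooth bump functions\<close>

text \<open>\<open>flat 0\<close> is the classical smooth function that vanishes to infinite order
  at 0. The powers of \<open>inverse s\<close> are included so that derivatives stay in the linear
  span of the family.\<close>

definition flat :: "nat \<Rightarrow> real \<Rightarrow> real" where
  "flat m s = (if 0 < s then inverse s ^ m * exp (- inverse s) else 0)"

lemma flat_tendsto_0: "(flat m \<longlongrightarrow> 0) (at 0)"
proof -
  have "((\<lambda>s. inverse s ^ m / exp (inverse s)) \<longlongrightarrow> 0) (at_right (0::real))"
    using filterlim_compose[OF tendsto_power_div_exp_0[of m] filterlim_inverse_at_top_right] .
  then have "(flat m \<longlongrightarrow> 0) (at_right 0)"
    by (rule Lim_transform_eventually)
      (auto simp: eventually_at_filter flat_def exp_minus field_simps)
  moreover have "(flat m \<longlongrightarrow> 0) (at_left 0)"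
    by (rule Lim_transform_eventually[OF tendsto_const])
      (auto simp: eventually_at_filter flat_def)
  ultimately show ?thesis by (simp add: filterlim_at_split)
qed

text \<open>Away from 0 this is the product rule. At 0 the difference quotient of
  \<open>flat m\<close> is exactly \<open>flat (m + 1)\<close>, which tends to 0 because the
  exponential beats every power.\<close>

lemma flat_has_derivative:
  "(flat m has_real_derivative (flat (m + 2) s - real m * flat (m + 1) s)) (at s)"
proof -
  consider "0 < s" | "s < 0" | "s = 0" by linarith
  then show ?thesis
  proof cases
    case 1
    have "((\<lambda>s. inverse s ^ m * exp (- inverse s)) has_real_derivative
      (flat (m + 2) s - real m * flat (m + 1) s)) (at s)"
    proof (rule DERIV_cong)
      show "((\<lambda>s. inverse s ^ m * exp (- inverse s)) has_real_derivative
        (real m * inverse s ^ (m - 1) * (- (inverse s ^ 2))) * exp (- inverse s) +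
        (exp (- inverse s) * (inverse s ^ 2)) * inverse s ^ m) (at s)"
        using 1 by (auto intro!: derivative_eq_intros simp: power2_eq_square)
      show "(real m * inverse s ^ (m - 1) * (- (inverse s ^ 2))) * exp (- inverse s) +
        (exp (- inverse s) * (inverse s ^ 2)) * inverse s ^ m = flat (m + 2) s - real m * flat (m + 1) s"
        using 1 by (cases m) (auto simp: flat_def power2_eq_square algebra_simps)
    qed
    then show ?thesis
      by (rule has_field_derivative_transform_within_open[where S = "{0<..}"])
        (use 1 in \<open>auto simp: flat_def\<close>)
  next
    case 2
    have "((\<lambda>s. 0) has_real_derivative (flat (m + 2) s - real m * flat (m + 1) s)) (at s)"
      using 2 by (simp add: flat_def)
    then show ?thesis
      by (rule has_field_derivative_transform_within_open[where S = "{..<0}"])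
        (use 2 in \<open>auto simp: flat_def\<close>)
  next
    case 3
    have eq: "(flat m x - flat m 0) / (x - 0) = flat (m + 1) x" for x
      by (simp add: flat_def field_simps)
    show ?thesis
      unfolding 3 has_field_derivative_iff eq
      using flat_tendsto_0[of "m + 1"] by (simp add: flat_def[of _ 0])
  qed
qed

text \<open>That the directional derivatives are again polynomials is the point: it closes
  \<open>bump_span\<close> under differentiation.\<close>

lemma real_polynomial_has_derivative:
  fixes p :: "'a::real_normed_vector \<Rightarrow> real"
  assumes "real_polynomial_function p"
  shows "\<exists>p'. (\<forall>x. (p has_derivative p' x) (at x)) \<and> (\<forall>v. real_polynomial_function (\<lambda>x. p' x v))"
  using assms
proof (induction p rule: real_polynomial_function.induct)
  case (linear f)
  then show ?case
    by (intro exI[of _ "\<lambda>x. f"]) (auto intro: bounded_linear_imp_has_derivative)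
next
  case (const c)
  show ?case by (intro exI[of _ "\<lambda>x v. 0"]) auto
next
  case (add f g)
  then obtain f' g' where "\<forall>x. (f has_derivative f' x) (at x)" "\<forall>v. real_polynomial_function (\<lambda>x. f' x v)"
    "\<forall>x. (g has_derivative g' x) (at x)" "\<forall>v. real_polynomial_function (\<lambda>x. g' x v)"
    by blast
  then show ?case
    by (intro exI[of _ "\<lambda>x v. f' x v + g' x v"]) (auto intro: has_derivative_add)
next
  case (mult f g)
  then obtain f' g' where "\<forall>x. (f has_derivative f' x) (at x)" "\<forall>v. real_polynomial_function (\<lambda>x. f' x v)"
    "\<forall>x. (g has_derivative g' x) (at x)" "\<forall>v. real_polynomial_function (\<lambda>x. g' x v)"
    by blast
  note d = this
  have "real_polynomial_function (\<lambda>x. f x * g' x v + f' x v * g x)" for v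
    by (rule real_polynomial_function.intros(3); rule real_polynomial_function.intros(4); rule mult.hyps d(2,4)[rule_format])
  with d(1,3) show ?case
    by (intro exI[of _ "\<lambda>x v. f x * g' x v + f' x v * g x"]) (auto intro: has_derivative_mult)
qed

text \<open>Closed under directional derivatives, so that all members are smooth.\<close>

inductive bump_span :: "real \<Rightarrow> ('a::euclidean_space \<Rightarrow> real) \<Rightarrow> bool" for r where
  base: "real_polynomial_function p \<Longrightarrow> bump_span r (\<lambda>x. p x * flat m (r - x \<bullet> x))"
| add: "bump_span r f \<Longrightarrow> bump_span r g \<Longrightarrow> bump_span r (\<lambda>x. f x + g x)"

lemma bump_span_has_derivative:
  fixes f :: "'a::euclidean_space \<Rightarrow> real"
  assumes "bump_span r f"
  shows "\<exists>f'. (\<forall>x. (f has_derivative f' x) (at x)) \<and> (\<forall>v. bump_span r (\<lambda>x. f' x v))"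
  using assms
proof (induction rule: bump_span.induct)
  case (base p m)
  obtain p' where p': "\<And>x. (p has_derivative p' x) (at x)" "\<And>v. real_polynomial_function (\<lambda>x. p' x v)"
    using real_polynomial_has_derivative[OF base] by blast
  let ?u = "\<lambda>x :: 'a. r - x \<bullet> x"
  \<comment> \<open>Grouped so that every summand is literally a polynomial times some
    \<open>flat\<close> of \<open>r - x \<bullet> x\<close>, as the rules of
    \<open>bump_span\<close> demand.\<close>
  define f' where "f' x v = (p x * (-2 * (x \<bullet> v))) * flat (m + 2) (?u x) +
    ((p x * (2 * m * (x \<bullet> v))) * flat (m + 1) (?u x) + p' x v * flat m (?u x))" for x v
  have lin: "real_polynomial_function (\<lambda>x :: 'a. c * (x \<bullet> v))" for c v
    by (intro real_polynomial_function.intros bounded_linear_inner_left)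
  have "((\<lambda>x. p x * flat m (?u x)) has_derivative f' x) (at x)" for x
  proof -
    have "(?u has_derivative (\<lambda>v. - 2 * (x \<bullet> v))) (at x)"
      by (auto intro!: derivative_eq_intros simp: inner_commute)
    then have "((\<lambda>x. flat m (?u x)) has_derivative
      (\<lambda>v. (flat (m + 2) (?u x) - real m * flat (m + 1) (?u x)) * (- 2 * (x \<bullet> v)))) (at x)"
      by (rule has_derivative_compose[OF _ flat_has_derivative[unfolded has_field_derivative_def]])
    from has_derivative_mult[OF p'(1) this]
    show ?thesis
      by (rule has_derivative_eq_rhs) (auto simp: f'_def algebra_simps)
  qed
  moreover have "bump_span r (\<lambda>x. f' x v)" for v
    unfolding f'_def
    by (intro bump_span.intros p'(2) real_polynomial_function.intros(4)[OF base] lin)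
  ultimately show ?case by blast
next
  case (add f g)
  then obtain f' g' where "\<forall>x. (f has_derivative f' x) (at x)" "\<forall>v. bump_span r (\<lambda>x. f' x v)"
    "\<forall>x. (g has_derivative g' x) (at x)" "\<forall>v. bump_span r (\<lambda>x. g' x v)"
    by blast
  then show ?case
    by (intro exI[of _ "\<lambda>x v. f' x v + g' x v"]) (auto intro: has_derivative_add bump_span.add)
qed

text \<open>\<open>Ck\<close> recurses through directional derivatives, so a class of differentiable
  functions closed under them is contained in every \<open>Ck k\<close>.\<close>

lemma bump_span_Ck: "bump_span r f \<Longrightarrow> Ck k f"
proof (induction k arbitrary: f)
  case 0
  obtain f' where "\<forall>x. (f has_derivative f' x) (at x)"
    using bump_span_has_derivative[OF 0] by blast
  then have "f differentiable_on UNIV"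
    by (auto simp: differentiable_on_def differentiable_def)
  then show ?case by (simp add: differentiable_imp_continuous_on)
next
  case (Suc k)
  obtain f' where f': "\<And>x. (f has_derivative f' x) (at x)" "\<And>v. bump_span r (\<lambda>x. f' x v)"
    using bump_span_has_derivative[OF Suc.prems] by blast
  have "frechet_derivative f (at x) = f' x" for x
    using frechet_derivative_at[OF f'(1)] by simp
  then show ?case
    using f' Suc.IH by (auto simp: differentiable_def)
qed

lemma flat_nonneg: "0 \<le> flat m s"
  by (simp add: flat_def)

lemma flat_pos_iff: "0 < flat m s \<longleftrightarrow> 0 < s"
  by (simp add: flat_def)

text \<open>The radial bump exp(-1 / (e^2 - |x|^2)), extended by 0 and divided by its integral. The
  integral is positive because the bump is positive on a ball of positive measure.\<close>

lemma bump_exists: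
  assumes e: "0 < e"
  shows "\<exists>\<phi> \<in> test_functions. (\<forall>x. 0 \<le> \<phi> x) \<and> (\<forall>x :: 'a::euclidean_space. e \<le> norm x \<longrightarrow> \<phi> x = 0) \<and>
    (\<integral>\<^sup>+x. ennreal (\<phi> x) \<partial>lborel) = 1"
proof -
  define b where "b x = flat 0 (e\<^sup>2 - x \<bullet> x)" for x :: 'a
  have b0: "b x = 0" if "e \<le> norm x" for x
    using power_mono[OF that, of 2] e by (simp add: b_def flat_def power2_norm_eq_inner)
  have bpos: "0 < b x" if "norm x < e" for x
    using power_strict_mono[OF that, of 2] by (simp add: b_def flat_pos_iff power2_norm_eq_inner)
  have b_nonneg: "0 \<le> b x" for x by (simp add: b_def flat_nonneg)
  have span: "bump_span (e\<^sup>2) (\<lambda>x. c * b x)" for c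
    unfolding b_def by (intro bump_span.base real_polynomial_function.intros)
  have test: "(\<lambda>x. c * b x) \<in> test_functions" for c
  proof -
    have "bounded {x. c * b x \<noteq> 0}"
      using b0 by (intro boundedI[of _ e]) (force simp: not_le[symmetric])
    then show ?thesis
      using bump_span_Ck[OF span] by (simp add: test_functions_def)
  qed
  have "b \<in> test_functions" using test[of 1] by simp
  then have int: "integrable lborel b" by (rule test_function_integrable)
  then have [measurable]: "b \<in> borel_measurable borel" by auto
  define I where "I = (\<integral>x. b x \<partial>lborel)"
  have I: "(\<integral>\<^sup>+x. ennreal (b x) \<partial>lborel) = ennreal I"
    unfolding I_def using int b_nonneg by (intro nn_integral_eq_integral) auto
  have "0 < I"
  proof (rule ccontr)
    assume "\<not> 0 < I"
    then have "(\<integral>\<^sup>+x. ennreal (b x) \<partial>lborel) = 0" using I by (simp add: ennreal_eq_0_iff)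
    then have "AE x in lborel. b x \<le> 0"
      by (subst (asm) nn_integral_0_iff_AE) (auto simp: ennreal_eq_0_iff)
    then have "AE x in lborel. x \<notin> ball (0 :: 'a) e"
    proof (rule eventually_mono)
      fix x assume "b x \<le> 0"
      then show "x \<notin> ball 0 e" using bpos[of x] by (cases "norm x < e") auto
    qed
    then have "emeasure lborel (ball (0::'a) e) = 0"
      by (subst (asm) AE_iff_measurable[OF _ refl]) (simp_all, simp add: ball_def)
    moreover have "0 < unit_ball_vol DIM('a) * e ^ DIM('a)"
      using e by simp
    ultimately show False using e by (simp add: emeasure_ball ennreal_eq_0_iff)
  qed
  have "(\<integral>\<^sup>+x. ennreal (1 / I * b x) \<partial>lborel) = ennreal (1 / I) * (\<integral>\<^sup>+x. ennreal (b x) \<partial>lborel)"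
    using \<open>0 < I\<close> b_nonneg by (subst nn_integral_cmult[symmetric]) (auto simp: ennreal_mult[symmetric])
  also have "\<dots> = 1"
    using \<open>0 < I\<close> by (simp add: I ennreal_mult[symmetric])
  finally have "(\<integral>\<^sup>+x. ennreal (1 / I * b x) \<partial>lborel) = 1" .
  then show ?thesis
    using \<open>0 < I\<close> b0 b_nonneg test[of "1 / I"] by (intro bexI[of _ "\<lambda>x. 1 / I * b x"]) auto
qed

subsection \<open>Mollification\<close>

lemma test_function_Ck: "f \<in> test_functions \<Longrightarrow> Ck k f"
  by (simp add: test_functions_def)

lemma test_function_supp: "f \<in> test_functions \<Longrightarrow> bounded {x. f x \<noteq> 0}"
  by (auto simp: test_functions_def intro: bounded_subset[OF compact_imp_bounded closure_subset])

lemma test_functionI: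
  fixes f :: "'a::euclidean_space \<Rightarrow> real"
  shows "(\<And>k. Ck k f) \<Longrightarrow> bounded {x. f x \<noteq> 0} \<Longrightarrow> f \<in> test_functions"
  by (simp add: test_functions_def)

lemma test_function_has_derivative:
  assumes "f \<in> test_functions"
  shows "(f has_derivative frechet_derivative f (at x)) (at x)"
  using test_function_Ck[OF assms, of 1] by (simp add: frechet_derivative_works)

text \<open>Makes inductions over the order of differentiation possible. Off the closed support f
  agrees with 0 on an open set, so the support does not grow.\<close>

lemma test_function_frechet_derivative:
  fixes f :: "'a::euclidean_space \<Rightarrow> real"
  assumes f: "f \<in> test_functions"
  shows "(\<lambda>x. frechet_derivative f (at x) v) \<in> test_functions"
proof (rule test_functionI)
  show "Ck k (\<lambda>x. frechet_derivative f (at x) v)" for k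
    using test_function_Ck[OF f, of "Suc k"] by simp
  have "frechet_derivative f (at x) v = 0" if "x \<notin> closure {x. f x \<noteq> 0}" for x
  proof -
    have "((\<lambda>_. 0) has_derivative (\<lambda>_. 0)) (at x)" by simp
    then have "(f has_derivative (\<lambda>_. 0)) (at x)"
      by (rule has_derivative_transform_within_open[where s = "- closure {x. f x \<noteq> 0}"])
        (use that closure_subset[of "{x. f x \<noteq> 0}"] in auto)
    then show ?thesis using frechet_derivative_at by metis
  qed
  then have "{x. frechet_derivative f (at x) v \<noteq> 0} \<subseteq> closure {x. f x \<noteq> 0}" by blast
  then show "bounded {x. frechet_derivative f (at x) v \<noteq> 0}"
    using f by (auto simp: test_functions_def dest: compact_imp_bounded intro: bounded_subset)
qed

lemma test_function_uniformly_continuous: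
  fixes f :: "'a::euclidean_space \<Rightarrow> real"
  assumes f: "f \<in> test_functions" and e: "0 < e"
  shows "\<exists>d>0. \<forall>x y. dist x y < d \<longrightarrow> \<bar>f x - f y\<bar> < e"
proof -
  obtain R where R: "\<And>x. f x \<noteq> 0 \<Longrightarrow> norm x \<le> R"
    using test_function_supp[OF f] by (auto simp: bounded_iff)
  have "uniformly_continuous_on (cball 0 (R + 1)) f"
    by (intro compact_uniformly_continuous continuous_on_subset[OF test_function_continuous[OF f]]) auto
  then obtain d where d: "0 < d" "\<And>x y. x \<in> cball 0 (R + 1) \<Longrightarrow> y \<in> cball 0 (R + 1) \<Longrightarrow> dist y x < d \<Longrightarrow> dist (f y) (f x) < e"
    using e unfolding uniformly_continuous_on_def by metis
  \<comment> \<open>The cap 1 keeps both points in the ball of radius \<open>R + 1\<close> once one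
    of them has norm at most R; otherwise both values are 0.\<close>
  have "\<bar>f x - f y\<bar> < e" if xy: "dist x y < min d 1" for x y
  proof (cases "norm x \<le> R \<or> norm y \<le> R")
    case True
    have "norm x \<le> norm y + dist x y" "norm y \<le> norm x + dist x y"
      using norm_triangle_ineq2[of x y] norm_triangle_ineq2[of y x] by (auto simp: dist_norm norm_minus_commute)
    then show ?thesis using d(2)[of y x] xy True by (auto simp: dist_real_def)
  next
    case False
    then have "f x = 0" "f y = 0" using R by blast+
    then show ?thesis using e by simp
  qed
  then show ?thesis using d(1) by (intro exI[of _ "min d 1"]) auto
qed

text \<open>The linearisation error must be uniform in x to be integrated against an arbitrary
  integrable function in \<open>mollify_has_derivative\<close>. The mean value theorem along the
  segment reduces it to uniform continuity of the derivatives in the basis directions.\<close>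

lemma test_function_uniformly_differentiable:
  fixes f :: "'a::euclidean_space \<Rightarrow> real"
  assumes f: "f \<in> test_functions" and e: "0 < e"
  shows "\<exists>d>0. \<forall>x h. norm h < d \<longrightarrow> \<bar>f (x + h) - f x - frechet_derivative f (at x) h\<bar> \<le> e * norm h"
proof -
  let ?D = "\<lambda>x. frechet_derivative f (at x)"
  have lin: "linear (?D x)" for x
    using test_function_has_derivative[OF f] has_derivative_linear by blast
  \<comment> \<open>Each basis direction contributes at most \<open>norm h * e'\<close>.\<close>
  define e' where "e' = e / DIM('a)"
  have e': "0 < e'" using e by (simp add: e'_def)
  have "\<forall>b\<in>(Basis :: 'a set). \<exists>d>0. \<forall>x y. dist x y < d \<longrightarrow> \<bar>?D x b - ?D y b\<bar> < e'"
    using test_function_uniformly_continuous[OF test_function_frechet_derivative[OF f] e'] by blast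
  then obtain d where d: "\<And>b. b \<in> (Basis :: 'a set) \<Longrightarrow> 0 < d b"
    "\<And>b x y. b \<in> (Basis :: 'a set) \<Longrightarrow> dist x y < d b \<Longrightarrow> \<bar>?D x b - ?D y b\<bar> < e'"
    by metis
  define d0 where "d0 = Min (d ` (Basis :: 'a set))"
  have d0: "0 < d0" "\<And>b. b \<in> (Basis :: 'a set) \<Longrightarrow> d0 \<le> d b"
    unfolding d0_def using d(1) by auto
  have near: "\<bar>?D y h - ?D x h\<bar> \<le> e * norm h" if xy: "dist y x < d0" for x y h
  proof -
    have D: "?D z h = (\<Sum>b\<in>Basis. (h \<bullet> b) * ?D z b)" for z
    proof -
      have "?D z h = ?D z (\<Sum>b\<in>Basis. (h \<bullet> b) *\<^sub>R b)" by (simp add: euclidean_representation)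
      also have "\<dots> = (\<Sum>b\<in>Basis. (h \<bullet> b) * ?D z b)"
        using lin[of z] by (simp add: linear_sum linear_cmul)
      finally show ?thesis .
    qed
    have "?D y h - ?D x h = (\<Sum>b\<in>Basis. (h \<bullet> b) * (?D y b - ?D x b))"
      unfolding D[of y] D[of x] by (simp add: sum_subtractf right_diff_distrib)
    also have "\<bar>\<dots>\<bar> \<le> (\<Sum>b\<in>(Basis :: 'a set). norm h * e')"
    proof (intro order.trans[OF sum_abs] sum_mono)
      fix b :: 'a assume b: "b \<in> Basis"
      have "\<bar>?D y b - ?D x b\<bar> \<le> e'"
        using d(2)[OF b, of y x] d0(2)[OF b] xy by simp
      then show "\<bar>(h \<bullet> b) * (?D y b - ?D x b)\<bar> \<le> norm h * e'"
        unfolding abs_mult using Basis_le_norm[OF b] e' by (intro mult_mono) auto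
    qed
    also have "\<dots> = e * norm h" by (simp add: e'_def)
    finally show ?thesis .
  qed
  have "\<bar>f (x + h) - f x - ?D x h\<bar> \<le> e * norm h" if h: "norm h < d0" for x h
  proof -
    have "((\<lambda>t. f (x + t *\<^sub>R h)) has_real_derivative ?D (x + t *\<^sub>R h) h) (at t)" for t :: real
    proof -
      have "((\<lambda>t. x + t *\<^sub>R h) has_derivative (\<lambda>s. s *\<^sub>R h)) (at t)"
        by (auto intro!: derivative_eq_intros)
      from has_derivative_compose[OF this test_function_has_derivative[OF f]]
      show ?thesis
        unfolding has_field_derivative_def
        by (rule has_derivative_eq_rhs) (auto simp: linear_cmul[OF lin] mult.commute)
    qed
    then obtain t where t: "0 < t" "t < 1" "f (x + 1 *\<^sub>R h) - f (x + 0 *\<^sub>R h) = (1 - 0) * ?D (x + t *\<^sub>R h) h"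
      using MVT2[of 0 1 "\<lambda>t. f (x + t *\<^sub>R h)" "\<lambda>t. ?D (x + t *\<^sub>R h) h"] by (auto simp del: scaleR_one)
    have "norm (t *\<^sub>R h) \<le> norm h"
      using t by (simp add: mult_left_le_one_le)
    then have "dist (x + t *\<^sub>R h) x < d0" using h by (simp add: dist_norm)
    from near[OF this, of h] t(3) show ?thesis by simp
  qed
  then show ?thesis using d0(1) by blast
qed

lemma test_function_bounded:
  fixes f :: "'a::euclidean_space \<Rightarrow> real"
  assumes f: "f \<in> test_functions"
  shows "\<exists>B. \<forall>x. \<bar>f x\<bar> \<le> B"
proof -
  have "compact (f ` closure {x. f x \<noteq> 0})"
    using f test_function_continuous[OF f] continuous_on_subset
    by (intro compact_continuous_image) (auto simp: test_functions_def)
  then have "bounded (f ` closure {x. f x \<noteq> 0})" by (rule compact_imp_bounded)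
  then obtain B where "\<forall>y \<in> f ` closure {x. f x \<noteq> 0}. norm y \<le> B" by (auto simp: bounded_iff)
  then have B: "\<bar>f x\<bar> \<le> B" if "x \<in> closure {x. f x \<noteq> 0}" for x using that by auto
  have "\<bar>f x\<bar> \<le> max B 0" for x
  proof (cases "f x = 0")
    case False
    then have "x \<in> closure {x. f x \<noteq> 0}" using closure_subset[of "{x. f x \<noteq> 0}"] by blast
    from B[OF this] show ?thesis by simp
  qed simp
  then show ?thesis by blast
qed

text \<open>A convolution with the variable x placed in the kernel, so that all derivatives fall on
  the kernel and g may be an indicator.\<close>

definition mollify :: "('a::euclidean_space \<Rightarrow> real) \<Rightarrow> ('a \<Rightarrow> real) \<Rightarrow> 'a \<Rightarrow> real" where
  "mollify \<phi> g x = (\<integral>y. g y * \<phi> (x - y) \<partial>lborel)"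

lemma integrable_mult_bounded:
  fixes g \<psi> :: "'a \<Rightarrow> real"
  assumes g: "integrable M g" and [measurable]: "\<psi> \<in> borel_measurable M" and B: "\<And>y. \<bar>\<psi> y\<bar> \<le> B"
  shows "integrable M (\<lambda>y. g y * \<psi> y)"
proof (rule Bochner_Integration.integrable_bound[where f = "\<lambda>y. B * g y"])
  show "AE y in M. norm (g y * \<psi> y) \<le> norm (B * g y)"
  proof (intro always_eventually allI)
    fix y
    have "\<bar>\<psi> y\<bar> \<le> \<bar>B\<bar>" using order.trans[OF B abs_ge_self] .
    then show "norm (g y * \<psi> y) \<le> norm (B * g y)"
      by (simp add: abs_mult mult.commute[of "\<bar>B\<bar>"] mult_left_mono)
  qed
qed (use g in auto)

lemma mollify_integrable:
  assumes g: "integrable lborel g" and \<phi>: "\<phi> \<in> test_functions"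
  shows "integrable lborel (\<lambda>y. g y * \<phi> (x - y))"
proof -
  obtain B where B: "\<And>x. \<bar>\<phi> x\<bar> \<le> B" using test_function_bounded[OF \<phi>] by blast
  have [measurable]: "\<phi> \<in> borel_measurable borel"
    using test_function_integrable[OF \<phi>] by auto
  show ?thesis by (rule integrable_mult_bounded[OF g _ B]) measurable
qed

lemma mollify_has_derivative:
  fixes g :: "'a::euclidean_space \<Rightarrow> real"
  assumes g: "integrable lborel g" and \<phi>: "\<phi> \<in> test_functions"
  shows "(mollify \<phi> g has_derivative (\<lambda>h. mollify (\<lambda>x. frechet_derivative \<phi> (at x) h) g x)) (at x)"
proof -
  let ?D = "\<lambda>x. frechet_derivative \<phi> (at x)"
  let ?M = "\<lambda>h. mollify (\<lambda>x. ?D x h) g x"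
  have lin: "linear (?D x)" for x
    using test_function_has_derivative[OF \<phi>] has_derivative_linear by blast
  note int = mollify_integrable[OF g \<phi>] mollify_integrable[OF g test_function_frechet_derivative[OF \<phi>]]
  let ?G = "\<integral>y. \<bar>g y\<bar> \<partial>lborel"
  show ?thesis
    unfolding has_derivative_at_alt
  proof (intro conjI allI impI)
    have "linear ?M"
    proof (rule linearI)
      show "?M (h1 + h2) = ?M h1 + ?M h2" for h1 h2
        unfolding mollify_def Bochner_Integration.integral_add[OF int(2) int(2), symmetric]
        by (simp add: linear_add[OF lin] distrib_left)
      show "?M (r *\<^sub>R h) = r *\<^sub>R ?M h" for r h
        unfolding mollify_def by (simp add: linear_cmul[OF lin] mult.left_commute)
    qed
    then show "bounded_linear ?M" by (simp add: linear_conv_bounded_linear)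
    fix e :: real assume e: "0 < e"
    have G: "0 \<le> ?G" by simp
    \<comment> \<open>The 1 guards against division by zero when g vanishes almost
      everywhere.\<close>
    define e' where "e' = e / (?G + 1)"
    have e': "0 < e'" using e G by (simp add: e'_def add_nonneg_pos)
    have Ge: "?G * e' \<le> e"
    proof -
      have "?G * e' \<le> (?G + 1) * e'" using e' by (intro mult_right_mono) auto
      also have "\<dots> = e"
        unfolding e'_def using less_imp_neq[OF add_nonneg_pos[OF G zero_less_one]] by simp
      finally show ?thesis .
    qed
    obtain d where d: "0 < d" "\<And>x h. norm h < d \<Longrightarrow> \<bar>\<phi> (x + h) - \<phi> x - ?D x h\<bar> \<le> e' * norm h"
      using test_function_uniformly_differentiable[OF \<phi> e'] by blast
    have "norm (mollify \<phi> g z - mollify \<phi> g x - ?M (z - x)) \<le> e * norm (z - x)" if z: "norm (z - x) < d" for z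
    proof -
      have "mollify \<phi> g z - mollify \<phi> g x - ?M (z - x)
        = (\<integral>y. g y * (\<phi> (z - y) - \<phi> (x - y) - ?D (x - y) (z - x)) \<partial>lborel)"
        unfolding mollify_def using int
        by (simp add: right_diff_distrib)
      also have "\<bar>\<dots>\<bar> \<le> (\<integral>y. \<bar>g y\<bar> * (e' * norm (z - x)) \<partial>lborel)"
      proof (rule order.trans[OF integral_abs_bound integral_mono])
        show "integrable lborel (\<lambda>y. \<bar>g y * (\<phi> (z - y) - \<phi> (x - y) - ?D (x - y) (z - x))\<bar>)"
          unfolding right_diff_distrib using int by (intro integrable_abs Bochner_Integration.integrable_diff)
        show "integrable lborel (\<lambda>y. \<bar>g y\<bar> * (e' * norm (z - x)))"
          using g by (intro integrable_mult_left integrable_abs)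
        fix y
        have "z - y = (x - y) + (z - x)" by simp
        then have "\<bar>\<phi> (z - y) - \<phi> (x - y) - ?D (x - y) (z - x)\<bar> \<le> e' * norm (z - x)"
          using d(2)[OF z, of "x - y"] by simp
        then show "\<bar>g y * (\<phi> (z - y) - \<phi> (x - y) - ?D (x - y) (z - x))\<bar> \<le> \<bar>g y\<bar> * (e' * norm (z - x))"
          unfolding abs_mult by (intro mult_left_mono) auto
      qed
      also have "\<dots> = (?G * e') * norm (z - x)" by simp
      also have "\<dots> \<le> e * norm (z - x)" by (intro mult_right_mono Ge) auto
      finally show ?thesis by simp
    qed
    then show "\<exists>d>0. \<forall>z. norm (z - x) < d \<longrightarrow> norm (mollify \<phi> g z - mollify \<phi> g x - ?M (z - x)) \<le> e * norm (z - x)"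
      using d(1) by blast
  qed
qed

text \<open>The induction generalises over the kernel: a derivative of the mollification is the
  mollification with a derivative of the kernel, again a test function.\<close>

lemma mollify_Ck:
  fixes g :: "'a::euclidean_space \<Rightarrow> real"
  assumes g: "integrable lborel g"
  shows "\<phi> \<in> test_functions \<Longrightarrow> Ck k (mollify \<phi> g)"
proof (induction k arbitrary: \<phi>)
  case 0
  then have "mollify \<phi> g differentiable_on UNIV"
    using mollify_has_derivative[OF g] by (auto simp: differentiable_on_def differentiable_def)
  then show ?case by (simp add: differentiable_imp_continuous_on)
next
  case (Suc k)
  have "frechet_derivative (mollify \<phi> g) (at x) = (\<lambda>h. mollify (\<lambda>x. frechet_derivative \<phi> (at x) h) g x)" for x
    using frechet_derivative_at[OF mollify_has_derivative[OF g Suc.prems]] by simp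
  moreover have "mollify \<phi> g differentiable (at x)" for x
    using mollify_has_derivative[OF g Suc.prems] by (auto simp: differentiable_def)
  ultimately show ?case
    using Suc.IH[OF test_function_frechet_derivative[OF Suc.prems]] by simp
qed

subsection \<open>From the embedding to tents\<close>

lemma epowr_mult:
  assumes "0 < a" "0 \<le> q"
  shows "epowr (ennreal a * x) q = ennreal (a powr q) * epowr x q"
  using assms
  by (cases x rule: ennreal_cases)
    (simp_all add: ennreal_mult[symmetric] epowr_ennreal powr_mult ennreal_mult_top)

text \<open>By translation invariance the shift moves from the kernel to g, so differences commute
  with mollification.\<close>

lemma mollify_shift_diff:
  fixes g :: "'a::euclidean_space \<Rightarrow> real"
  assumes g: "integrable lborel g" and \<phi>: "\<phi> \<in> test_functions"
  shows "mollify \<phi> g (x + h) - mollify \<phi> g x = (\<integral>y. (g (h + y) - g y) * \<phi> (x - y) \<partial>lborel)"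
    and "integrable lborel (\<lambda>y. (g (h + y) - g y) * \<phi> (x - y))"
proof -
  have [measurable]: "\<phi> \<in> borel_measurable borel" "g \<in> borel_measurable borel"
    using test_function_integrable[OF \<phi>] g by auto
  let ?F = "\<lambda>y. g y * \<phi> (x + h - y)"
  have eq: "(\<lambda>y. ?F (h + y)) = (\<lambda>y. g (h + y) * \<phi> (x - y))"
    by (auto simp: algebra_simps)
  have "integrable (distr lborel borel ((+) h)) ?F"
    using mollify_integrable[OF g \<phi>] by (simp add: lborel_distr_plus)
  then have "integrable lborel (\<lambda>y. ?F (h + y))"
    by (rule integrable_distr[rotated]) simp
  then have int: "integrable lborel (\<lambda>y. g (h + y) * \<phi> (x - y))"
    unfolding eq .
  have "mollify \<phi> g (x + h) = (\<integral>y. ?F y \<partial>distr lborel borel ((+) h))"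
    by (simp add: lborel_distr_plus mollify_def)
  also have "\<dots> = (\<integral>y. ?F (h + y) \<partial>lborel)"
    by (rule integral_distr) simp_all
  also have "\<dots> = (\<integral>y. g (h + y) * \<phi> (x - y) \<partial>lborel)"
    unfolding eq ..
  finally show "mollify \<phi> g (x + h) - mollify \<phi> g x = (\<integral>y. (g (h + y) - g y) * \<phi> (x - y) \<partial>lborel)"
    using int mollify_integrable[OF g \<phi>] by (simp add: mollify_def left_diff_distrib)
  show "integrable lborel (\<lambda>y. (g (h + y) - g y) * \<phi> (x - y))"
    using int mollify_integrable[OF g \<phi>] by (simp add: left_diff_distrib)
qed

text \<open>For each fixed h, convolution with a probability density does not increase the L^1 norm
  of the difference, by Fubini.\<close>

lemma sobolev_seminorm_mollify_le:
  fixes g :: "real ^ 'n \<Rightarrow> real" and \<beta> :: real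
  assumes g: "integrable lborel g" and \<phi>: "\<phi> \<in> test_functions" "\<And>x. 0 \<le> \<phi> x"
    "(\<integral>\<^sup>+x. ennreal (\<phi> x) \<partial>lborel) = 1"
  shows "sobolev_seminorm \<beta> (mollify \<phi> g) \<le> sobolev_seminorm \<beta> g"
  unfolding sobolev_seminorm_eq
proof (rule nn_integral_mono, rule mult_right_mono)
  fix h :: "real ^ 'n"
  have [measurable]: "\<phi> \<in> borel_measurable borel" "g \<in> borel_measurable borel"
    using test_function_integrable[OF \<phi>(1)] g by auto
  have "(\<integral>\<^sup>+x. ennreal \<bar>mollify \<phi> g (x + h) - mollify \<phi> g x\<bar> \<partial>lborel)
    \<le> (\<integral>\<^sup>+x. (\<integral>\<^sup>+y. ennreal \<bar>g (h + y) - g y\<bar> * ennreal (\<phi> (x - y)) \<partial>lborel) \<partial>lborel)"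
  proof (intro nn_integral_mono)
    fix x
    have "ennreal \<bar>mollify \<phi> g (x + h) - mollify \<phi> g x\<bar>
      \<le> (\<integral>\<^sup>+y. ennreal (norm ((g (h + y) - g y) * \<phi> (x - y))) \<partial>lborel)"
      unfolding mollify_shift_diff(1)[OF g \<phi>(1)] real_norm_def[symmetric]
      by (intro integral_norm_bound_ennreal mollify_shift_diff(2)[OF g \<phi>(1)])
    also have "\<dots> = (\<integral>\<^sup>+y. ennreal \<bar>g (h + y) - g y\<bar> * ennreal (\<phi> (x - y)) \<partial>lborel)"
      by (intro nn_integral_cong) (simp add: abs_mult \<phi>(2) ennreal_mult)
    finally show "ennreal \<bar>mollify \<phi> g (x + h) - mollify \<phi> g x\<bar> \<le> \<dots>" .
  qed
  also have "\<dots> = (\<integral>\<^sup>+y. (\<integral>\<^sup>+x. ennreal \<bar>g (h + y) - g y\<bar> * ennreal (\<phi> (x - y)) \<partial>lborel) \<partial>lborel)"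
    by (rule lborel_pair.Fubini') measurable
  also have "\<dots> = (\<integral>\<^sup>+y. ennreal \<bar>g (y + h) - g y\<bar> \<partial>lborel)"
  proof (rule nn_integral_cong)
    fix y
    have "(\<integral>\<^sup>+x. ennreal (\<phi> (x - y)) \<partial>lborel) = (\<integral>\<^sup>+x. ennreal (\<phi> (- y + x)) \<partial>lborel)"
      by simp
    also have "\<dots> = 1"
      using \<phi>(3) by (subst nn_integral_lborel_shift[where f = "\<lambda>x. ennreal (\<phi> x)"]) auto
    finally show "(\<integral>\<^sup>+x. ennreal \<bar>g (h + y) - g y\<bar> * ennreal (\<phi> (x - y)) \<partial>lborel) = ennreal \<bar>g (y + h) - g y\<bar>"
      by (subst nn_integral_cmult) (auto simp: add.commute)
  qed
  finally show "(\<integral>\<^sup>+x. ennreal \<bar>mollify \<phi> g (x + h) - mollify \<phi> g x\<bar> \<partial>lborel)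
    \<le> (\<integral>\<^sup>+x. ennreal \<bar>g (x + h) - g x\<bar> \<partial>lborel)" .
qed auto

text \<open>The difference of indicators is nonzero exactly where the shift h leaves or enters U.
  Entering under h is leaving under -h, and the kernel is even, so both cases contribute one
  perimeter.\<close>

lemma sobolev_seminorm_indicator:
  fixes U :: "(real ^ 'n) set" and \<beta> :: real
  assumes U [measurable]: "U \<in> sets borel"
  shows "sobolev_seminorm \<beta> (indicator U) = 2 * fractional_perimeter \<beta> U"
proof -
  let ?k = "\<lambda>h :: real ^ 'n. ennreal (norm h powr - (CARD('n) + \<beta>))"
  let ?m = "\<lambda>h. \<integral>\<^sup>+x. indicator U x * indicator (- U) (x + h) \<partial>lborel"
  have split: "(\<integral>\<^sup>+x. ennreal \<bar>indicator U (x + h) - indicator U x\<bar> \<partial>lborel) = ?m h + ?m (- h)" for h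
  proof -
    have "(\<integral>\<^sup>+x. ennreal \<bar>indicator U (x + h) - indicator U x\<bar> \<partial>lborel)
      = (\<integral>\<^sup>+x. indicator U x * indicator (- U) (x + h) + indicator (- U) x * indicator U (x + h) \<partial>lborel)"
      by (intro nn_integral_cong) (auto simp: indicator_def)
    also have "\<dots> = ?m h + (\<integral>\<^sup>+x. indicator (- U) x * indicator U (x + h) \<partial>lborel)"
      by (rule nn_integral_add) measurable
    also have "(\<integral>\<^sup>+x. indicator (- U) x * indicator U (x + h) \<partial>lborel)
      = (\<integral>\<^sup>+x. indicator (- U) (- h + x) * indicator U (- h + x + h) \<partial>lborel)"
      by (rule nn_integral_lborel_shift[symmetric]) measurable
    also have "\<dots> = ?m (- h)"
      by (simp add: mult.commute add.commute)
    finally show ?thesis .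
  qed
  have m [measurable]: "?m \<in> borel_measurable borel" by measurable
  have "sobolev_seminorm \<beta> (indicator U) = (\<integral>\<^sup>+h. ?m h * ?k h + ?m (0 - h) * ?k (0 - h) \<partial>lborel)"
    unfolding sobolev_seminorm_eq split by (intro nn_integral_cong) (simp add: distrib_right)
  also have "\<dots> = (\<integral>\<^sup>+h. ?m h * ?k h \<partial>lborel) + (\<integral>\<^sup>+h. ?m (0 - h) * ?k (0 - h) \<partial>lborel)"
    by (rule nn_integral_add) measurable
  also have "(\<integral>\<^sup>+h. ?m (0 - h) * ?k (0 - h) \<partial>lborel) = (\<integral>\<^sup>+h. ?m h * ?k h \<partial>lborel)"
    by (rule nn_integral_lborel_reflect) measurable
  finally show ?thesis
    by (simp add: fractional_perimeter_eq_shift[OF U] mult_2)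
qed

section \<open>Lower bound for the extension, and tents\<close>

lemma poisson_kernel_ge_near:
  fixes y :: "real ^ 'n" and \<alpha> t :: real
  assumes \<alpha>: "0 < \<alpha>" and t: "0 < t" and y: "norm y \<le> t"
  shows "poisson_const CARD('n) \<alpha> * 2 powr (- (CARD('n) + \<alpha>) / 2) / t ^ CARD('n) \<le> poisson_kernel \<alpha> t y"
proof -
  let ?p = "CARD('n) + \<alpha>"
  have "(norm y)\<^sup>2 + t\<^sup>2 \<le> 2 * t\<^sup>2"
    using power_mono[OF y norm_ge_zero, of 2] by simp
  then have "(2 * t\<^sup>2) powr (- ?p / 2) \<le> ((norm y)\<^sup>2 + t\<^sup>2) powr (- ?p / 2)"
    using \<alpha> t by (intro powr_mono2') (simp_all add: sum_power2_gt_zero_iff)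
  moreover have "(2 * t\<^sup>2) powr (- ?p / 2) = 2 powr (- ?p / 2) * t powr - ?p"
    using t powr_half_square[of t "- ?p"] by (subst powr_mult) simp_all
  ultimately have "t powr \<alpha> * (2 powr (- ?p / 2) * t powr - ?p) \<le> t powr \<alpha> * ((norm y)\<^sup>2 + t\<^sup>2) powr (- ?p / 2)"
    by (intro mult_left_mono) simp_all
  moreover have "t powr \<alpha> * (2 powr (- ?p / 2) * t powr - ?p) = 2 powr (- ?p / 2) / t ^ CARD('n)"
  proof -
    have "t powr \<alpha> * t powr - ?p = 1 / t ^ CARD('n)"
      using t by (subst powr_add[symmetric]) (simp add: powr_minus_divide powr_realpow)
    then show ?thesis by (simp only: mult.left_commute[of "t powr \<alpha>"]) simp
  qed
  ultimately have "poisson_const CARD('n) \<alpha> * (2 powr (- ?p / 2) / t ^ CARD('n))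
    \<le> poisson_const CARD('n) \<alpha> * (t powr \<alpha> * ((norm y)\<^sup>2 + t\<^sup>2) powr (- ?p / 2))"
    using poisson_const_pos[OF \<alpha>, of "CARD('n)"] by (intro mult_left_mono) simp_all
  then show ?thesis by (simp add: poisson_kernel_def mult.assoc)
qed

text \<open>On the ball of radius t/2 about x the kernel is at least a constant times
  \<open>t^(-n)\<close>, and the volume is of order \<open>t^n\<close>, so c does not depend on t.
  Half the radius leaves room for the mollification, which spoils the value 1 near the boundary of
  U.\<close>

lemma poisson_ext_ge:
  fixes \<alpha> :: real
  assumes \<alpha>: "0 < \<alpha>"
  shows "\<exists>c>0. \<forall>f \<in> test_functions. \<forall>(x :: real ^ 'n) t. 0 < t \<longrightarrow> (\<forall>y. 0 \<le> f y) \<longrightarrow>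
    (\<forall>y\<in>ball x (t / 2). 1 \<le> f y) \<longrightarrow> c \<le> poisson_ext \<alpha> f (x, t)"
proof -
  let ?n = "CARD('n)" and ?v = "unit_ball_vol CARD('n)"
  define b where "b = poisson_const ?n \<alpha> * 2 powr (- (?n + \<alpha>) / 2)"
  have b: "0 < b" using poisson_const_pos[OF \<alpha>, of ?n] by (simp add: b_def)
  have "b * ?v / 2 ^ ?n \<le> poisson_ext \<alpha> f (x, t)"
    if f: "f \<in> test_functions" and t: "0 < t" and nonneg: "\<And>y. 0 \<le> f y"
      and one: "\<And>y. y \<in> ball x (t / 2) \<Longrightarrow> 1 \<le> f y"
    for f and x :: "real ^ 'n" and t
  proof -
    have [measurable]: "f \<in> borel_measurable borel" using test_function_integrable[OF f] by auto
    obtain B where B: "\<And>x. \<bar>f x\<bar> \<le> B" using test_function_bounded[OF f] by blast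
    obtain C where C: "\<And>t x. 0 < t \<Longrightarrow> (\<integral>\<^sup>+y. ennreal (poisson_kernel \<alpha> t ((x :: real ^ 'n) - y)) \<partial>lborel) \<le> ennreal C"
      using nn_integral_poisson_kernel_le[where 'n = 'n, OF \<alpha>] by blast
    \<comment> \<open>Needed for a lower bound: without integrability the Bochner integral would
      default to 0.\<close>
    have "integrable lborel (\<lambda>y. poisson_kernel \<alpha> t (x - y))"
      using le_less_trans[OF C[OF t, of x] ennreal_less_top]
      by (intro integrableI_nonneg) (simp_all add: poisson_kernel_nonneg[OF \<alpha>])
    then have int: "integrable lborel (\<lambda>y. poisson_kernel \<alpha> t (x - y) * f y)"
      by (rule integrable_mult_bounded[OF _ _ B]) simp
    have "b * ?v / 2 ^ ?n = b / t ^ ?n * (?v * (t / 2) ^ ?n)"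
      using t by (simp add: power_divide)
    also have "ennreal \<dots> = ennreal (b / t ^ ?n) * emeasure lborel (ball x (t / 2))"
      using t b by (simp add: emeasure_ball ennreal_mult[symmetric])
    also have "\<dots> = (\<integral>\<^sup>+y. ennreal (b / t ^ ?n) * indicator (ball x (t / 2)) y \<partial>lborel)"
      by (rule nn_integral_cmult_indicator[symmetric]) simp
    also have "\<dots> \<le> (\<integral>\<^sup>+y. ennreal (poisson_kernel \<alpha> t (x - y) * f y) \<partial>lborel)"
    proof (intro nn_integral_mono)
      fix y
      show "ennreal (b / t ^ ?n) * indicator (ball x (t / 2)) y \<le> ennreal (poisson_kernel \<alpha> t (x - y) * f y)"
      proof (cases "y \<in> ball x (t / 2)")
        case True
        then have "b / t ^ ?n \<le> poisson_kernel \<alpha> t (x - y)"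
          unfolding b_def using t by (intro poisson_kernel_ge_near \<alpha>) (auto simp: dist_norm)
        moreover have "poisson_kernel \<alpha> t (x - y) * 1 \<le> poisson_kernel \<alpha> t (x - y) * f y"
          by (intro mult_left_mono one True poisson_kernel_nonneg \<alpha>)
        ultimately show ?thesis using True by (simp add: ennreal_leI)
      qed simp
    qed
    also have "\<dots> = ennreal (poisson_ext \<alpha> f (x, t))"
      unfolding poisson_ext_def prod.case
      by (intro nn_integral_eq_integral int always_eventually allI mult_nonneg_nonneg nonneg poisson_kernel_nonneg \<alpha>)
    finally show ?thesis
      by (rule ennreal_le_iff[THEN iffD1, rotated])
        (auto simp: poisson_ext_def intro!: Bochner_Integration.integral_nonneg mult_nonneg_nonneg nonneg poisson_kernel_nonneg \<alpha>)
  qed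
  moreover have "0 < b * ?v / 2 ^ ?n" using b by simp
  ultimately show ?thesis
    by (intro exI[of _ "b * ?v / 2 ^ ?n"] conjI ballI allI impI) simp_all
qed

proposition tent_inequality_if_trace_inequality:
  fixes \<alpha> \<beta> q :: real and \<mu> :: "((real ^ 'n) \<times> real) measure"
  assumes \<alpha>: "0 < \<alpha>" and q: "1 \<le> q" and R: "radon_measure_on half_space \<mu>"
    and C: "C < \<infinity>" "\<And>f. f \<in> test_functions \<Longrightarrow>
      Lq_norm \<mu> q (poisson_ext \<alpha> f) \<le> C * sobolev_seminorm \<beta> f"
  shows "\<exists>C'::ennreal. C' < \<infinity> \<and> (\<forall>U. open U \<and> bounded U \<longrightarrow>
    epowr (emeasure \<mu> (tent U)) (1 / q) \<le> C' * fractional_perimeter \<beta> U)"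
proof -
  obtain c where c: "0 < c" "\<forall>f \<in> test_functions. \<forall>(x :: real ^ 'n) t. 0 < t \<longrightarrow> (\<forall>y. 0 \<le> f y) \<longrightarrow>
    (\<forall>y\<in>ball x (t / 2). 1 \<le> f y) \<longrightarrow> c \<le> poisson_ext \<alpha> f (x, t)"
    using poisson_ext_ge[where 'n = 'n, OF \<alpha>] by (elim exE conjE)
  \<comment> \<open>The factor 2 relates the seminorm of the indicator to the perimeter;
    \<open>1 / c\<close> undoes the lower bound on the extension.\<close>
  let ?C' = "ennreal (1 / c) * (C * 2)"
  have "epowr (emeasure \<mu> (tent U)) (1 / q) \<le> ?C' * fractional_perimeter \<beta> U"
    if U: "open U" "bounded U" for U :: "(real ^ 'n) set"
  proof -
    let ?P = "C * (2 * fractional_perimeter \<beta> U)"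
    let ?g = "indicator U :: real ^ 'n \<Rightarrow> real"
    have [measurable]: "U \<in> sets borel" using U(1) by simp
    have g: "integrable lborel ?g"
      using emeasure_bounded_finite[OF U(2)] by (intro integrable_real_indicator) auto
    \<comment> \<open>One mollification scale serves a whole \<open>T m\<close>, since heights there
      are bounded below. The bound on its measure does not involve m, so it passes to the
      union.\<close>
    define T where "T m = tent U \<inter> {p. 1 / real (Suc m) \<le> snd p}" for m
    have T_meas: "T m \<in> sets \<mu>" for m
      unfolding T_def using tent_subset[of U]
      by (intro radon_sets[OF R] sets.Int tent_borel) (auto intro!: borel_closed closed_Collect_le continuous_intros)
    have T_bound: "emeasure \<mu> (T m) \<le> epowr (ennreal (1 / c) * ?P) q" for m
    proof -
      \<comment> \<open>With \<open>2 * e \<le> t\<close>, every y in B(x, t/2) has B(y, e) inside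
        B(x, t), hence inside U, so f equals 1 at y.\<close>
      define e where "e = 1 / real (Suc m) / 2"
      have e: "0 < e" "2 * e = 1 / real (Suc m)" by (simp_all add: e_def del: of_nat_Suc)
      obtain \<phi> where \<phi>: "\<phi> \<in> test_functions" "\<And>x. 0 \<le> \<phi> x" "\<And>x :: real ^ 'n. e \<le> norm x \<Longrightarrow> \<phi> x = 0"
        "(\<integral>\<^sup>+x. ennreal (\<phi> x) \<partial>lborel) = 1"
        using bump_exists[where 'a = "real ^ 'n", OF e(1)] by blast
      have [measurable]: "\<phi> \<in> borel_measurable borel" using test_function_integrable[OF \<phi>(1)] by auto
      define f where "f = mollify \<phi> ?g"
      have f_nonneg: "0 \<le> f x" for x
        unfolding f_def mollify_def by (intro Bochner_Integration.integral_nonneg) (simp add: \<phi>(2))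
      have f_one: "f x = 1" if "ball x e \<subseteq> U" for x
      proof -
        have "f x = (\<integral>y. \<phi> (x - y) \<partial>lborel)"
          unfolding f_def mollify_def
        proof (intro Bochner_Integration.integral_cong refl)
          fix y
          show "?g y * \<phi> (x - y) = \<phi> (x - y)"
          proof (cases "dist x y < e")
            case True
            then have "y \<in> U" using that by auto
            then show ?thesis by simp
          next
            case False
            then show ?thesis using \<phi>(3)[of "x - y"] by (simp add: dist_norm)
          qed
        qed
        also have "\<dots> = enn2real (\<integral>\<^sup>+y. ennreal (\<phi> (x - y)) \<partial>lborel)"
          by (intro integral_eq_nn_integral) (auto simp: \<phi>(2))
        also have "(\<integral>\<^sup>+y. ennreal (\<phi> (x - y)) \<partial>lborel) = 1"
          using \<phi>(4) by (subst nn_integral_lborel_reflect[where f = "\<lambda>y. ennreal (\<phi> y)"]) auto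
        finally show ?thesis by simp
      qed
      have f_test: "f \<in> test_functions"
      proof (rule test_functionI)
        show "Ck k f" for k unfolding f_def by (intro mollify_Ck g \<phi>(1))
        obtain B where B: "\<And>y. y \<in> U \<Longrightarrow> norm y \<le> B" using U(2) by (auto simp: bounded_iff)
        have "f x = 0" if x: "B + e < norm x" for x
        proof -
          have "?g y * \<phi> (x - y) = 0" for y
          proof (cases "y \<in> U")
            case True
            have "norm x \<le> norm y + norm (x - y)" by (rule norm_triangle_sub)
            then show ?thesis using B[OF True] x \<phi>(3)[of "x - y"] by simp
          qed simp
          then show ?thesis unfolding f_def mollify_def by (simp only: Bochner_Integration.integral_zero)
        qed
        then show "bounded {x. f x \<noteq> 0}"
          by (intro boundedI[of _ "B + e"]) (auto simp: not_less[symmetric])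
      qed
      have "ennreal (c powr q) * emeasure \<mu> (T m) = (\<integral>\<^sup>+\<xi>. ennreal (c powr q) * indicator (T m) \<xi> \<partial>\<mu>)"
        by (rule nn_integral_cmult_indicator[symmetric, OF T_meas])
      also have "\<dots> \<le> (\<integral>\<^sup>+\<xi>. ennreal (\<bar>poisson_ext \<alpha> f \<xi>\<bar> powr q) \<partial>\<mu>)"
      proof (intro nn_integral_mono)
        fix \<xi> :: "(real ^ 'n) \<times> real"
        obtain x t where xt: "\<xi> = (x, t)" by (cases \<xi>)
        show "ennreal (c powr q) * indicator (T m) \<xi> \<le> ennreal (\<bar>poisson_ext \<alpha> f \<xi>\<bar> powr q)"
        proof (cases "\<xi> \<in> T m")
          case True
          then have t: "0 < t" "ball x t \<subseteq> U" "2 * e \<le> t"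
            by (auto simp: T_def tent_def xt e(2) simp del: of_nat_Suc)
          have "c \<le> poisson_ext \<alpha> f (x, t)"
          proof (rule c(2)[rule_format, OF f_test t(1) f_nonneg])
            fix y assume y: "y \<in> ball x (t / 2)"
            have "ball y e \<subseteq> U"
            proof
              fix z assume "z \<in> ball y e"
              then have "dist x z < t" using y t(3) dist_triangle[of x z y] by simp
              then show "z \<in> U" using t(2) by auto
            qed
            then show "1 \<le> f y" using f_one by simp
          qed
          then have "c powr q \<le> \<bar>poisson_ext \<alpha> f \<xi>\<bar> powr q"
            using c(1) q by (intro powr_mono2) (auto simp: xt)
          then show ?thesis using True by (simp add: ennreal_leI)
        qed simp
      qed
      finally have "epowr (ennreal (c powr q) * emeasure \<mu> (T m)) (1 / q) \<le> Lq_norm \<mu> q (poisson_ext \<alpha> f)"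
        unfolding Lq_norm_def using q by (intro epowr_mono) auto
      also have "\<dots> \<le> C * sobolev_seminorm \<beta> f"
        by (rule C(2)[OF f_test])
      also have "\<dots> \<le> ?P"
        unfolding f_def sobolev_seminorm_indicator[symmetric, OF \<open>U \<in> sets borel\<close>]
        by (intro mult_left_mono sobolev_seminorm_mollify_le g \<phi>) auto
      finally have "epowr (epowr (ennreal (c powr q) * emeasure \<mu> (T m)) (1 / q)) q \<le> epowr ?P q"
        using q by (intro epowr_mono) auto
      then have "ennreal (c powr q) * emeasure \<mu> (T m) \<le> epowr ?P q"
        using epowr_epowr_inverse[of "1 / q" "ennreal (c powr q) * emeasure \<mu> (T m)"] q by simp
      then have "ennreal ((1 / c) powr q) * (ennreal (c powr q) * emeasure \<mu> (T m)) \<le> ennreal ((1 / c) powr q) * epowr ?P q"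
        by (intro mult_left_mono) auto
      moreover have "ennreal ((1 / c) powr q) * ennreal (c powr q) = 1"
        using c(1) by (simp add: ennreal_mult[symmetric] powr_mult[symmetric])
      moreover have "epowr (ennreal (1 / c) * ?P) q = ennreal ((1 / c) powr q) * epowr ?P q"
        using c(1) q by (intro epowr_mult) auto
      ultimately show ?thesis
        by (simp add: mult.assoc[symmetric])
    qed
    have "tent U = (\<Union>m. T m)"
    proof
      show "tent U \<subseteq> (\<Union>m. T m)"
      proof
        fix p assume p: "p \<in> tent U"
        then have "0 < snd p" by (auto simp: tent_def)
        then obtain m :: nat where "inverse (real (Suc m)) < snd p" using reals_Archimedean by blast
        with p show "p \<in> (\<Union>m. T m)" by (auto simp: T_def inverse_eq_divide intro!: exI[of _ m])
      qed
    qed (auto simp: T_def)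
    moreover have "incseq T"
    proof (rule incseq_SucI)
      fix m
      have "1 / real (Suc (Suc m)) \<le> 1 / real (Suc m)" by (simp add: frac_le)
      then show "T m \<subseteq> T (Suc m)" unfolding T_def by (auto simp del: of_nat_Suc)
    qed
    ultimately have "emeasure \<mu> (tent U) = (SUP m. emeasure \<mu> (T m))"
      using SUP_emeasure_incseq[of T \<mu>] T_meas by (simp add: image_subset_iff)
    also have "\<dots> \<le> epowr (ennreal (1 / c) * ?P) q"
      by (intro SUP_least T_bound)
    finally have "epowr (emeasure \<mu> (tent U)) (1 / q) \<le> epowr (epowr (ennreal (1 / c) * ?P) q) (1 / q)"
      using q by (intro epowr_mono) auto
    then show ?thesis
      using q by (simp add: epowr_epowr_inverse mult.assoc)
  qed
  moreover have "?C' < \<infinity>"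
    using C(1) by (simp add: ennreal_mult_less_top)
  ultimately show ?thesis by blast
qed

theorem theorem4p4:
  fixes \<alpha> \<beta> q :: real and \<mu> :: "((real ^ 'n) \<times> real) measure"
  assumes "0 < \<alpha>" "\<alpha> < 2" and "0 < \<beta>" "\<beta> < 1" and "1 \<le> q"
    and "radon_measure_on half_space \<mu>"
  shows "(\<exists>C::ennreal. C < \<infinity> \<and>
            (\<forall>f\<in>test_functions. Lq_norm \<mu> q (poisson_ext \<alpha> f) \<le> C * sobolev_seminorm \<beta> f))
     \<longleftrightarrow> (\<exists>C'::ennreal. C' < \<infinity> \<and>
            (\<forall>U. open U \<and> bounded U \<longrightarrow>
               epowr (emeasure \<mu> (tent U)) (1 / q) \<le> C' * fractional_perimeter \<beta> U))"
proof
  assume "\<exists>C::ennreal. C < \<infinity> \<and>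
    (\<forall>f\<in>test_functions. Lq_norm \<mu> q (poisson_ext \<alpha> f) \<le> C * sobolev_seminorm \<beta> f)"
  then show "\<exists>C'::ennreal. C' < \<infinity> \<and> (\<forall>U. open U \<and> bounded U \<longrightarrow>
      epowr (emeasure \<mu> (tent U)) (1 / q) \<le> C' * fractional_perimeter \<beta> U)"
    using tent_inequality_if_trace_inequality[OF assms(1,5,6)] by blast
next
  assume "\<exists>C'::ennreal. C' < \<infinity> \<and> (\<forall>U. open U \<and> bounded U \<longrightarrow>
      epowr (emeasure \<mu> (tent U)) (1 / q) \<le> C' * fractional_perimeter \<beta> U)"
  then show "\<exists>C::ennreal. C < \<infinity> \<and>
    (\<forall>f\<in>test_functions. Lq_norm \<mu> q (poisson_ext \<alpha> f) \<le> C * sobolev_seminorm \<beta> f)"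
    using trace_inequality_if_tent_inequality[OF assms(1,3,4,5,6)] by blast
qed

end
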